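(* Let $\Omega\subset\mathbb{C}^n$ be a bounded $\mathbb{C}$-convex domain and let $\varphi:\Omega\to\mathbb{R}$ be a bounded function such that the set $\{(z,w)\in\Omega\times\mathbb{C}:|w|<e^{-\varphi(z)}\}$ is open (for instance, $\varphi$ upper semicontinuous). Then the domain $$\Omega_\varphi=\big\{(z,w)\in\mathbb{C}^n\times\mathbb{C}: z\in\Omega,\ 0<|w|<e^{-\varphi(z)}\big\}$$ endowed with the Kobayashi distance $k_{\Omega_\varphi}$ is not Gromov hyperbolic.
   Context: A domain is a non-empty connected open set. A domain $\Omega\subset\mathbb{C}^n$ is $\mathbb{C}$-convex if every non-empty intersection of $\Omega$ with a complex affine line is a simply connected domain (in that line). Let $\mathbb{D}=\{\lambda\in\mathbb{C}:|\lambda|<1\}$. For a domain $G\subset\mathbb{C}^N$ the Kobayashi pseudometric is $\kappa_G(z;X)=\inf\{|\lambda|:\text{there is a holomorphic } f:\mathbb{D}\to G \text{ with } f(0)=z,\ \lambda f'(0)=X\}$ for $z\in G$, $X\in\mathbb{C}^N$. The Kobayashi pseudodistance is $k_G(p,q)=\inf_\alpha\int_0^1\kappa_G(\alpha(t);\alpha'(t))\,dt$, the infimum over all piecewise $\mathcal{C}^1$ curves $\alpha:[0,1]\to G$ with $\alpha(0)=p$, $\alpha(1)=q$. It is a distance if $G$ is bounded. A metric space $(X,d)$ is Gromov hyperbolic if there is $\delta\ge0$ such that $(x|y)_o\ge\min\{(x|z)_o,(z|y)_o\}-\delta$ for all $x,y,z,o\in X$, where $(x|y)_o=\frac12\big(d(x,o)+d(y,o)-d(x,y)\big)$.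 For geodesic metric spaces this is equivalent to the existence of $M>0$ such that, in every geodesic triangle, each side lies in the $M$-neighbourhood of the union of the other two. *)

theory Defs
  imports "HOL-Complex_Analysis.Complex_Analysis"
begin

definition is_domain :: "'a::topological_space set \<Rightarrow> bool" where
  "is_domain G \<longleftrightarrow> open G \<and> connected G \<and> G \<noteq> {}"

definition complex_line :: "complex^'n \<Rightarrow> complex^'n \<Rightarrow> (complex^'n) set" where
  "complex_line a b = {a + \<zeta> *s b |\<zeta>. True}"

definition C_convex :: "(complex^'n) set \<Rightarrow> bool" where
  "C_convex \<Omega> \<longleftrightarrow> is_domain \<Omega> \<and>
     (\<forall>a b. b \<noteq> 0 \<and> \<Omega> \<inter> complex_line a b \<noteq> {} \<longrightarrow>
        openin (top_of_set (complex_line a b)) (\<Omega> \<inter> complex_line a b) \<and>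
        connected (\<Omega> \<inter> complex_line a b) \<and>
        simply_connected (\<Omega> \<inter> complex_line a b))"

definition holomorphic_map_on :: "(complex \<Rightarrow> complex^'m) \<Rightarrow> complex set \<Rightarrow> bool" where
  "holomorphic_map_on f S \<longleftrightarrow> (\<forall>i. (\<lambda>\<zeta>. f \<zeta> $ i) holomorphic_on S)"

definition vderiv :: "(complex \<Rightarrow> complex^'m) \<Rightarrow> complex \<Rightarrow> complex^'m" where
  "vderiv f \<zeta> = (\<chi> i. deriv (\<lambda>\<xi>. f \<xi> $ i) \<zeta>)"

definition kobayashi_metric :: "(complex^'m) set \<Rightarrow> complex^'m \<Rightarrow> complex^'m \<Rightarrow> real" where
  "kobayashi_metric G z X =
     Inf {cmod l |l. \<exists>f. holomorphic_map_on f (ball 0 1) \<and> f ` ball 0 1 \<subseteq> G \<and>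
                         f 0 = z \<and> l *s vderiv f 0 = X}"

text \<open>Piecewise C1 in the classical sense: on every closed piece of a finite partition the curve has
  a derivative (one-sided at the endpoints) that is continuous up to the endpoints.  The library's
  \<open>piecewise_C1_differentiable_on\<close> is weaker: it allows the derivative to be unbounded near the
  break points.\<close>

definition piecewise_C1_curve :: "(real \<Rightarrow> 'a::real_normed_vector) \<Rightarrow> bool" where
  "piecewise_C1_curve \<alpha> \<longleftrightarrow>
     (\<exists>(N::nat) s. s 0 = 0 \<and> s N = 1 \<and>
        (\<forall>i<N. s i < s (Suc i) \<and>
           (\<exists>D. continuous_on {s i..s (Suc i)} D \<and>
              (\<forall>t\<in>{s i..s (Suc i)}.
                 (\<alpha> has_vector_derivative D t) (at t within {s i..s (Suc i)})))))"

definition curves_joining :: "'a::real_normed_vector set \<Rightarrow> 'a \<Rightarrow> 'a \<Rightarrow> (real \<Rightarrow> 'a) set" where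
  "curves_joining G p q =
     {\<alpha>. piecewise_C1_curve \<alpha> \<and> \<alpha> ` {0..1} \<subseteq> G \<and> \<alpha> 0 = p \<and> \<alpha> 1 = q}"

text \<open>For open \<open>G\<close> the Kobayashi pseudometric is upper semicontinuous, so along a piecewise C1 curve
  in \<open>G\<close> the integrand is bounded and Borel away from the finitely many break points; the (unspecified)
  values at break points do not affect the integral.  For a domain \<open>G\<close> and \<open>p, q\<close> in \<open>G\<close> the infimum
  defining \<open>kobayashi_dist\<close> is finite, so \<open>enn2real\<close> loses nothing.\<close>

definition kobayashi_length :: "(complex^'m) set \<Rightarrow> (real \<Rightarrow> complex^'m) \<Rightarrow> ennreal" where
  "kobayashi_length G \<alpha> =
     (\<integral>\<^sup>+t\<in>{0..1}. ennreal (kobayashi_metric G (\<alpha> t) (vector_derivative \<alpha> (at t))) \<partial>lborel)"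

definition kobayashi_dist :: "(complex^'m) set \<Rightarrow> complex^'m \<Rightarrow> complex^'m \<Rightarrow> real" where
  "kobayashi_dist G p q = enn2real (INF \<alpha>\<in>curves_joining G p q. kobayashi_length G \<alpha>)"

definition gromov_product :: "('a \<Rightarrow> 'a \<Rightarrow> real) \<Rightarrow> 'a \<Rightarrow> 'a \<Rightarrow> 'a \<Rightarrow> real" where
  "gromov_product d b x y = (d x b + d y b - d x y) / 2"

definition gromov_hyperbolic :: "'a set \<Rightarrow> ('a \<Rightarrow> 'a \<Rightarrow> real) \<Rightarrow> bool" where
  "gromov_hyperbolic X d \<longleftrightarrow>
     (\<exists>\<delta>\<ge>0. \<forall>x\<in>X. \<forall>y\<in>X. \<forall>z\<in>X. \<forall>b\<in>X.
        gromov_product d b x y \<ge> min (gromov_product d b x z) (gromov_product d b z y) - \<delta>)"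

text \<open>The point \<open>(z, w)\<close> of \<open>\<complex>\<^sup>n \<times> \<complex> = \<complex>\<^sup>n\<^sup>+\<^sup>1\<close>, with \<open>None\<close> indexing the last coordinate.\<close>

definition append_coord :: "complex^'n \<Rightarrow> complex \<Rightarrow> complex^('n option)" where
  "append_coord z w = (\<chi> i. case i of Some j \<Rightarrow> z $ j | None \<Rightarrow> w)"

definition punctured_hartogs ::
    "(complex^'n) set \<Rightarrow> (complex^'n \<Rightarrow> real) \<Rightarrow> (complex^('n option)) set" where
  "punctured_hartogs \<Omega> \<phi> =
     {append_coord z w |z w. z \<in> \<Omega> \<and> 0 < cmod w \<and> cmod w < exp (- \<phi> z)}"

end

theory Submission
  imports Defs "HOL-Real_Asymp.Real_Asymp"
begin

text \<open>
  Near \<open>w = 0\<close> the domain \<open>\<Omega>\<^sub>\<phi>\<close> is coarsely the product of \<open>\<Omega>\<close> with the cusp of a punctured disc, and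
  such a product contains arbitrarily large rectangles, which no hyperbolic space tolerates: in a
  hyperbolic space a path that avoids a ball of radius \<open>L\<close> but joins two points whose geodesic runs
  through the centre of the ball has length exponential in \<open>L\<close>.

  Let \<open>\<bar>\<phi>\<bar> \<le> B\<close> on \<open>\<Omega>\<close>. The cusp is parametrised by \<open>\<tau> \<mapsto> w(\<tau>) = exp (-B) exp (- exp (2 \<tau>))\<close>. Over each
  point of \<open>\<Omega>\<close> there is the punctured disc of radius \<open>exp (-B)\<close>, in which \<open>w(\<tau>)\<close> moves with speed at
  most one; and \<open>\<Omega>\<^sub>\<phi>\<close> lies over the punctured disc of radius \<open>exp B\<close>, so the distance of points at
  heights \<open>\<tau>, \<tau>' \<ge> 0\<close> is at least \<open>\<bar>\<tau> - \<tau>'\<bar> - ln (1 + 2 B) / 2\<close>, whatever the base points are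
  (\<open>kobayashi_dist_cusp_le\<close>, \<open>kobayashi_dist_cusp_ge\<close>). Horizontally, the projection to \<open>\<Omega>\<close> and the
  embeddings of \<open>\<Omega>\<close> as slices \<open>w = w(\<tau>)\<close> do not increase distances.

  Now fix \<open>z\<^sub>0\<close> and choose \<open>p\<close> in \<open>\<Omega>\<close> with \<open>L = k\<^sub>\<Omega>(z\<^sub>0, p)\<close> large; this is possible because a bounded
  domain lies in a half-space that touches its boundary (\<open>kobayashi_dist_unbounded\<close>). Take
  \<open>(z\<^sub>0, w(L))\<close> as base point. The points \<open>(z\<^sub>0, w(0))\<close> and \<open>(z\<^sub>0, w(2 L))\<close> have a Gromov product that
  stays bounded, since the base point is halfway between them along the cusp. They are also joined by
  the three other sides of a rectangle,
  \<open>(z\<^sub>0, w(0)) \<rightarrow> (p, w(0)) \<rightarrow> (p, w(2 L)) \<rightarrow> (z\<^sub>0, w(2 L))\<close>,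
  all of whose points are at distance at least \<open>L - O(1)\<close> from the base point: the horizontal sides by
  their height, the vertical one because it lies over \<open>p\<close>. Each side splits into \<open>O(L)\<close> steps of length
  at most one, so \<open>O(log L)\<close> applications of the hyperbolicity inequality (\<open>gromov_product_chain\<close>) show
  that the same Gromov product is at least \<open>L - O(log L)\<close>. This is absurd for large \<open>L\<close>.
\<close>

no_notation fps_nth (infixl \<open>$\<close> 75)

section \<open>Long chains in Gromov hyperbolic spaces\<close>

text \<open>
  Splitting a chain in the middle costs one hyperbolicity inequality, so the loss is \<open>\<delta>\<close> times
  the depth of a binary tree with \<open>n\<close> leaves. The logarithmic loss is what makes long detours
  around the base point impossible.
\<close>

lemma gromov_product_chain:
  fixes x :: "nat \<Rightarrow> 'a"
  assumes hyp: "\<And>x y z. \<lbrakk>x \<in> X; y \<in> X; z \<in> X\<rbrakk> \<Longrightarrow>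
      gromov_product d b x y \<ge> min (gromov_product d b x z) (gromov_product d b z y) - \<delta>"
    and "\<delta> \<ge> 0" "1 \<le> n" "n \<le> 2 ^ k"
    and "\<And>i. i \<le> n \<Longrightarrow> x i \<in> X"
    and "\<And>i. i < n \<Longrightarrow> A \<le> gromov_product d b (x i) (x (Suc i))"
  shows "A - real k * \<delta> \<le> gromov_product d b (x 0) (x n)"
  using assms(3-6)
proof (induction k arbitrary: n x)
  case 0
  then show ?case by simp
next
  case (Suc k)
  show ?case
  proof (cases "n = 1")
    case True
    then have "A \<le> gromov_product d b (x 0) (x n)"
      using Suc.prems(4)[of 0] by simp
    moreover have "0 \<le> real (Suc k) * \<delta>"
      using \<open>\<delta> \<ge> 0\<close> by simp
    ultimately show ?thesis by linarith
  next
    case False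
    define m where "m = n div 2"
    have m: "1 \<le> m" "m \<le> 2 ^ k" "1 \<le> n - m" "n - m \<le> 2 ^ k" "m < n"
      using False Suc.prems(1,2) by (auto simp: m_def)
    have "A - real k * \<delta> \<le> gromov_product d b (x 0) (x m)"
      using Suc.IH[of m x] m Suc.prems(3,4) by simp
    moreover have "A - real k * \<delta> \<le> gromov_product d b (x m) (x n)"
      using Suc.IH[of "n - m" "\<lambda>i. x (m + i)"] m Suc.prems(3,4) by simp
    ultimately show ?thesis
      using hyp[of "x 0" "x n" "x m"] Suc.prems(3) m by (simp add: algebra_simps min_def split: if_splits)
  qed
qed

section \<open>The infinitesimal metric\<close>

text \<open>
  The Schwarz lemma, transported from the disc to the right half-plane by a Cayley map that sends
  \<open>h 0\<close> to \<open>0\<close>.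
\<close>

lemma deriv_bound_positive_real_part:
  assumes h: "h holomorphic_on ball 0 1" and pos: "\<And>\<zeta>. \<zeta> \<in> ball 0 1 \<Longrightarrow> Re (h \<zeta>) > 0"
  shows "cmod (deriv h 0) \<le> 2 * Re (h 0)"
proof -
  define a where "a = h 0"
  define g where "g = (\<lambda>\<zeta>. (h \<zeta> - a) / (h \<zeta> + cnj a))"
  have a: "Re a > 0" unfolding a_def by (rule pos) simp
  have nz: "h \<zeta> + cnj a \<noteq> 0" if "\<zeta> \<in> ball 0 1" for \<zeta>
  proof
    assume "h \<zeta> + cnj a = 0"
    then have "Re (h \<zeta>) + Re a = 0" by (metis complex_cnj(1) cnj.sel(1) plus_complex.sel(1) zero_complex.sel(1))
    then show False using pos[OF that] a by simp
  qed
  have holg: "g holomorphic_on ball 0 1"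
    unfolding g_def by (intro holomorphic_intros h) (use nz in auto)
  have g1: "cmod (g \<zeta>) < 1" if "norm \<zeta> < 1" for \<zeta>
  proof -
    have z: "\<zeta> \<in> ball 0 1" using that by simp
    have "(cmod (h \<zeta> + cnj a))\<^sup>2 - (cmod (h \<zeta> - a))\<^sup>2 = 4 * Re (h \<zeta>) * Re a"
      unfolding cmod_power2 by (simp add: power2_eq_square algebra_simps)
    moreover have "4 * Re (h \<zeta>) * Re a > 0" using pos[OF z] a by simp
    ultimately have "(cmod (h \<zeta> - a))\<^sup>2 < (cmod (h \<zeta> + cnj a))\<^sup>2" by linarith
    then have "cmod (h \<zeta> - a) < cmod (h \<zeta> + cnj a)" by (simp add: power2_less_imp_less)
    then show ?thesis using nz[OF z] by (simp add: g_def norm_divide)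
  qed
  have "cmod (deriv g 0) \<le> 1"
    by (rule Schwarz_Lemma(2)[OF holg _ g1, of 0]) (auto simp: g_def a_def)
  moreover have "deriv g 0 = deriv h 0 / (a + cnj a)"
  proof -
    have "(h has_field_derivative deriv h 0) (at 0)"
      using h by (simp add: holomorphic_derivI)
    then have "(g has_field_derivative
        (deriv h 0 * (h 0 + cnj a) - (h 0 - a) * deriv h 0) / ((h 0 + cnj a) * (h 0 + cnj a))) (at 0)"
      unfolding g_def using nz[of 0]
      by (auto intro!: derivative_eq_intros)
    then have "(g has_field_derivative deriv h 0 / (a + cnj a)) (at 0)"
      using nz[of 0] by (simp add: a_def)
    then show ?thesis by (rule DERIV_imp_deriv)
  qed
  moreover have "a + cnj a = of_real (2 * Re a)" by (simp add: complex_add_cnj)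
  ultimately show ?thesis
    using a by (simp add: norm_divide a_def)
qed

definition analytic_disc :: "(complex^'m) set \<Rightarrow> (complex \<Rightarrow> complex^'m) \<Rightarrow> bool" where
  "analytic_disc G f \<longleftrightarrow> holomorphic_map_on f (ball 0 1) \<and> f ` ball 0 1 \<subseteq> G"

text \<open>
  The set whose infimum is the Kobayashi metric; naming it allows comparing metrics by comparing sets.
\<close>

definition disc_scalings :: "(complex^'m) set \<Rightarrow> complex^'m \<Rightarrow> complex^'m \<Rightarrow> real set" where
  "disc_scalings G z X = {cmod l |l. \<exists>f. analytic_disc G f \<and> f 0 = z \<and> l *s vderiv f 0 = X}"

lemma kobayashi_metric_eq_Inf: "kobayashi_metric G z X = Inf (disc_scalings G z X)"
  by (simp add: kobayashi_metric_def disc_scalings_def analytic_disc_def conj_assoc)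

lemma bdd_below_disc_scalings: "bdd_below (disc_scalings G z X)"
  by (rule bdd_belowI[of _ 0]) (auto simp: disc_scalings_def)

lemma disc_scalingsI:
  "analytic_disc G f \<Longrightarrow> f 0 = z \<Longrightarrow> l *s vderiv f 0 = X \<Longrightarrow> cmod l \<in> disc_scalings G z X"
  by (auto simp: disc_scalings_def)

lemma kobayashi_metric_le:
  "analytic_disc G f \<Longrightarrow> f 0 = z \<Longrightarrow> l *s vderiv f 0 = X \<Longrightarrow> kobayashi_metric G z X \<le> cmod l"
  unfolding kobayashi_metric_eq_Inf
  by (intro cInf_lower bdd_below_disc_scalings disc_scalingsI)

lemma vderiv_affine_disc: "vderiv (\<lambda>\<zeta>. z + \<zeta> *s v) 0 = v"
proof -
  have "((\<lambda>\<xi>. z $ i + \<xi> * v $ i) has_field_derivative v $ i) (at 0)" for i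
    by (auto intro!: derivative_eq_intros)
  then show ?thesis
    by (simp add: vderiv_def vec_eq_iff DERIV_imp_deriv)
qed

lemma norm_complex_smult: "norm (c *s v) = cmod c * norm (v :: complex^'m)"
  by (simp add: norm_vec_def norm_mult L2_set_right_distrib)

lemma analytic_disc_affine:
  assumes "ball z e \<subseteq> G" "norm v \<le> e" "e > 0"
  shows "analytic_disc G (\<lambda>\<zeta>. z + \<zeta> *s v)"
proof -
  have "z + \<zeta> *s v \<in> G" if "cmod \<zeta> < 1" for \<zeta>
  proof -
    have "cmod \<zeta> * norm v \<le> cmod \<zeta> * e" using assms(2) by (intro mult_left_mono) auto
    also have "\<dots> < e" using that \<open>e > 0\<close> by simp
    finally have "z + \<zeta> *s v \<in> ball z e" by (simp add: dist_norm norm_complex_smult)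
    then show ?thesis using assms(1) by auto
  qed
  then show ?thesis
    by (auto simp: analytic_disc_def holomorphic_map_on_def intro!: holomorphic_intros)
qed

text \<open>
  An affine disc inside a ball around \<open>z\<close> is a competitor. This gives non-emptiness for open sets,
  which the real-valued infimum needs in order to mean anything, and the bound that makes curves in
  open sets have finite length.
\<close>

lemma disc_scalings_of_ball:
  assumes "ball z e \<subseteq> G" "e > 0"
  shows "norm X / e \<in> disc_scalings G z X"
proof (cases "X = 0")
  case True
  then show ?thesis
    using disc_scalingsI[OF analytic_disc_affine[of z e G 0], of z 0 X] assms
    by (simp add: vderiv_affine_disc norm_divide)
next
  case False
  define v where "v = of_real (e / norm X) *s X"
  have "norm v \<le> e" using False assms by (simp add: v_def norm_complex_smult norm_divide)
  moreover have "of_real (norm X / e) *s v = X"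
    using False assms by (simp add: v_def vector_smult_assoc)
  ultimately show ?thesis
    using disc_scalingsI[OF analytic_disc_affine[of z e G v], of z "of_real (norm X / e)" X] assms
    by (simp add: vderiv_affine_disc norm_divide)
qed

lemma disc_scalings_nonempty:
  assumes "open G" "z \<in> G"
  shows "disc_scalings G z X \<noteq> {}"
  using assms disc_scalings_of_ball by (metis empty_iff open_contains_ball_eq)

lemma kobayashi_metric_le_ball:
  assumes "ball z e \<subseteq> G" "e > 0"
  shows "kobayashi_metric G z X \<le> norm X / e"
  unfolding kobayashi_metric_eq_Inf
  by (intro cInf_lower bdd_below_disc_scalings disc_scalings_of_ball assms)

lemma kobayashi_metric_zero:
  assumes "open G" "z \<in> G"
  shows "kobayashi_metric G z 0 \<le> 0"
  using assms kobayashi_metric_le_ball[of z _ G 0] by (auto simp: open_contains_ball)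

lemma kobayashi_metric_minus: "kobayashi_metric G z (- X) = kobayashi_metric G z X"
proof -
  have "disc_scalings G z X \<subseteq> disc_scalings G z (- X)" for X
  proof
    fix a assume "a \<in> disc_scalings G z X"
    then obtain l f where f: "analytic_disc G f" "f 0 = z" "l *s vderiv f 0 = X" and a: "a = cmod l"
      by (auto simp: disc_scalings_def)
    have "(- l) *s vderiv f 0 = - X"
      using f(3) by (auto simp: vec_eq_iff)
    then show "a \<in> disc_scalings G z (- X)"
      using disc_scalingsI[OF f(1,2), of "- l"] a by simp
  qed
  from this[of X] this[of "- X"] show ?thesis
    by (simp add: kobayashi_metric_eq_Inf)
qed

lemma analytic_disc_matrix:
  fixes A :: "complex^'m^'k"
  assumes f: "analytic_disc G f" and T: "\<And>x. x \<in> G \<Longrightarrow> A *v x + c \<in> H"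
  shows "analytic_disc H (\<lambda>\<zeta>. A *v f \<zeta> + c)"
    and "vderiv (\<lambda>\<zeta>. A *v f \<zeta> + c) 0 = A *v vderiv f 0"
proof -
  have hol: "(\<lambda>\<zeta>. f \<zeta> $ i) holomorphic_on ball 0 1" for i
    using f by (simp add: analytic_disc_def holomorphic_map_on_def)
  show "analytic_disc H (\<lambda>\<zeta>. A *v f \<zeta> + c)"
    using f T by (auto simp: analytic_disc_def holomorphic_map_on_def matrix_vector_mult_def
        intro!: holomorphic_intros)
  have "((\<lambda>\<xi>. (A *v f \<xi> + c) $ i) has_field_derivative (A *v vderiv f 0) $ i) (at 0)" for i
    unfolding matrix_vector_mult_def vderiv_def
    by (auto intro!: derivative_eq_intros holomorphic_derivI[OF hol] sum.cong simp: mult.commute)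
  then show "vderiv (\<lambda>\<zeta>. A *v f \<zeta> + c) 0 = A *v vderiv f 0"
    by (simp add: vderiv_def[of "\<lambda>\<zeta>. A *v f \<zeta> + c"] vec_eq_iff DERIV_imp_deriv)
qed

lemma matrix_vector_mult_smult: "A *v (l *s x) = l *s (A *v (x :: complex^'m))"
  by (simp add: vec_eq_iff matrix_vector_mult_def sum_distrib_left mult_ac)

text \<open>
  Composing with a complex affine map takes discs to discs with the same scaling factor.
\<close>

lemma kobayashi_metric_matrix_le:
  fixes A :: "complex^'m^'k"
  assumes "open G" "z \<in> G" and T: "\<And>x. x \<in> G \<Longrightarrow> A *v x + c \<in> H"
  shows "kobayashi_metric H (A *v z + c) (A *v X) \<le> kobayashi_metric G z X"
  unfolding kobayashi_metric_eq_Inf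
proof (rule cInf_superset_mono[OF disc_scalings_nonempty[OF assms(1,2)] bdd_below_disc_scalings], safe)
  fix a assume "a \<in> disc_scalings G z X"
  then obtain l f where f: "analytic_disc G f" "f 0 = z" "l *s vderiv f 0 = X" and a: "a = cmod l"
    by (auto simp: disc_scalings_def)
  show "a \<in> disc_scalings H (A *v z + c) (A *v X)"
    unfolding a using f
    by (intro disc_scalingsI[OF analytic_disc_matrix(1)[OF f(1) T]])
      (auto simp: analytic_disc_matrix(2)[OF f(1) T] matrix_vector_mult_smult)
qed

lemma has_derivative_disc:
  assumes "analytic_disc G f"
  shows "(f has_derivative (\<lambda>\<zeta>. \<zeta> *s vderiv f 0)) (at 0)"
proof -
  have "((\<lambda>\<zeta>. f \<zeta> $ i) has_derivative (\<lambda>\<zeta>. (\<zeta> *s vderiv f 0) $ i)) (at 0)" for i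
    using assms holomorphic_derivI[of "\<lambda>\<zeta>. f \<zeta> $ i" "ball 0 1" 0]
    by (simp add: analytic_disc_def holomorphic_map_on_def vderiv_def has_field_derivative_def
        mult_commute_abs)
  then show ?thesis
    by (subst has_derivative_componentwise_within) 
      (auto simp: Basis_vec_def inner_axis intro!: derivative_eq_intros)
qed

text \<open>
  The source of all explicit lower bounds. A positive function \<open>\<rho>\<close> that is, along each disc, the real part
  of a holomorphic function makes \<open>G\<close> look like a half-plane from inside each disc, and \<open>\<bar>d\<rho>\<bar> / (2 \<rho>)\<close> is
  the hyperbolic metric of a half-plane. The conjugate function need not exist on \<open>G\<close> itself, so
  \<open>log (1 / \<bar>w\<bar>)\<close> on a punctured disc is admissible without passing to the universal cover.
\<close>

lemma kobayashi_metric_ge_pluriharmonic: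
  assumes "open G" "z \<in> G"
    and \<rho>: "(\<rho> has_derivative \<rho>') (at z)"
    and h: "\<And>f. analytic_disc G f \<Longrightarrow> \<exists>h. h holomorphic_on ball 0 1 \<and>
               (\<forall>\<zeta>\<in>ball 0 1. Re (h \<zeta>) = \<rho> (f \<zeta>))"
    and pos: "\<And>x. x \<in> G \<Longrightarrow> \<rho> x > 0"
  shows "\<bar>\<rho>' X\<bar> / (2 * \<rho> z) \<le> kobayashi_metric G z X"
  unfolding kobayashi_metric_eq_Inf
proof (rule cInf_greatest[OF disc_scalings_nonempty[OF assms(1,2)]])
  fix a assume "a \<in> disc_scalings G z X"
  then obtain l f where f: "analytic_disc G f" "f 0 = z" "l *s vderiv f 0 = X" and a: "a = cmod l"
    by (auto simp: disc_scalings_def)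
  obtain h where h: "h holomorphic_on ball 0 1" "\<And>\<zeta>. \<zeta> \<in> ball 0 1 \<Longrightarrow> Re (h \<zeta>) = \<rho> (f \<zeta>)"
    using h[OF f(1)] by auto
  have "((\<lambda>\<zeta>. \<rho> (f \<zeta>)) has_derivative (\<lambda>\<zeta>. \<rho>' (\<zeta> *s vderiv f 0))) (at 0)"
    using has_derivative_compose[OF has_derivative_disc[OF f(1)], of \<rho> \<rho>'] \<rho> f(2) by simp
  then have "((\<lambda>\<zeta>. Re (h \<zeta>)) has_derivative (\<lambda>\<zeta>. \<rho>' (\<zeta> *s vderiv f 0))) (at 0)"
    by (rule has_derivative_transform_within_open[of _ _ _ _ "ball 0 1"]) (auto simp: h(2))
  moreover have "((\<lambda>\<zeta>. Re (h \<zeta>)) has_derivative (\<lambda>\<zeta>. Re (deriv h 0 * \<zeta>))) (at 0)"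
    using holomorphic_derivI[OF h(1), of 0]
    by (auto simp: has_field_derivative_def intro!: derivative_eq_intros)
  ultimately have "(\<lambda>\<zeta>. \<rho>' (\<zeta> *s vderiv f 0)) = (\<lambda>\<zeta>. Re (deriv h 0 * \<zeta>))"
    by (rule has_derivative_unique)
  then have "\<rho>' X = Re (deriv h 0 * l)"
    using f(3) by (metis)
  then have "\<bar>\<rho>' X\<bar> \<le> cmod (deriv h 0) * cmod l"
    by (metis abs_Re_le_cmod norm_mult)
  also have "cmod (deriv h 0) \<le> 2 * \<rho> z"
  proof -
    have "Re (h \<zeta>) > 0" if "\<zeta> \<in> ball 0 1" for \<zeta>
    proof -
      have "f \<zeta> \<in> G" using that f(1) by (auto simp: analytic_disc_def)
      then show ?thesis using that h(2) pos by simp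
    qed
    from deriv_bound_positive_real_part[OF h(1) this] show ?thesis
      using h(2)[of 0] f(2) by simp
  qed
  finally show "\<bar>\<rho>' X\<bar> / (2 * \<rho> z) \<le> a"
    using pos[OF assms(2)] a by (simp add: field_simps mult_right_mono)
qed

section \<open>Piecewise continuously differentiable curves\<close>

definition C1_between :: "(real \<Rightarrow> 'a::real_normed_vector) \<Rightarrow> real \<Rightarrow> real \<Rightarrow> bool" where
  "C1_between \<alpha> u v \<longleftrightarrow> (\<exists>D. continuous_on {u..v} D \<and>
     (\<forall>t\<in>{u..v}. (\<alpha> has_vector_derivative D t) (at t within {u..v})))"

lemma C1_between_subset:
  assumes "C1_between \<alpha> u v" "u \<le> u'" "v' \<le> v"
  shows "C1_between \<alpha> u' v'"
proof -
  have sub: "{u'..v'} \<subseteq> {u..v}" using assms by auto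
  show ?thesis
    using assms(1) sub unfolding C1_between_def
    by (meson continuous_on_subset has_vector_derivative_within_subset subsetD)
qed

lemma C1_between_cong:
  assumes "C1_between \<alpha> u v" "\<And>t. t \<in> {u..v} \<Longrightarrow> \<alpha> t = \<beta> t"
  shows "C1_between \<beta> u v"
proof -
  obtain D where D: "continuous_on {u..v} D"
      "\<And>t. t \<in> {u..v} \<Longrightarrow> (\<alpha> has_vector_derivative D t) (at t within {u..v})"
    using assms(1) unfolding C1_between_def by blast
  have "(\<beta> has_vector_derivative D t) (at t within {u..v})" if "t \<in> {u..v}" for t
    by (rule has_vector_derivative_transform[OF that _ D(2)[OF that]]) (simp add: assms(2))
  then show ?thesis using D(1) unfolding C1_between_def by blast
qed

lemma piecewise_C1_curve_pieces:
  "piecewise_C1_curve \<alpha> \<longleftrightarrow> (\<exists>(N::nat) s. s 0 = 0 \<and> s N = 1 \<and>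
     (\<forall>i<N. s i < s (Suc i) \<and> C1_between \<alpha> (s i) (s (Suc i))))"
  by (simp add: piecewise_C1_curve_def C1_between_def)

lemma partition_index:
  fixes s :: "nat \<Rightarrow> real"
  assumes "s 0 \<le> u" "u < s N"
  obtains i where "i < N" "s i \<le> u" "u < s (Suc i)"
proof -
  define i where "i = (GREATEST i. i \<le> N \<and> s i \<le> u)"
  have i: "i \<le> N \<and> s i \<le> u"
    unfolding i_def by (rule GreatestI_nat[of _ 0 N]) (use assms in auto)
  have "i \<noteq> N" using i assms by auto
  then have "i < N" using i by simp
  moreover have "u < s (Suc i)"
  proof (rule ccontr)
    assume "\<not> u < s (Suc i)"
    then have "Suc i \<le> i"
      using \<open>i < N\<close> unfolding i_def by (intro Greatest_le_nat[of _ _ N]) (auto simp flip: i_def)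
    then show False by simp
  qed
  ultimately show ?thesis using that i by blast
qed

text \<open>
  With a finite set of break points instead of an ordered partition, adding further break points and
  transforming the parameter become set operations.
\<close>

lemma piecewise_C1_curve_iff_breaks:
  "piecewise_C1_curve \<alpha> \<longleftrightarrow>
     (\<exists>P. finite P \<and> (\<forall>u v. 0 \<le> u \<and> u < v \<and> v \<le> 1 \<and> {u<..<v} \<inter> P = {} \<longrightarrow> C1_between \<alpha> u v))"
proof
  assume "piecewise_C1_curve \<alpha>"
  then obtain N s where s: "s 0 = 0" "s (N::nat) = 1"
      "\<And>i. i < N \<Longrightarrow> s i < s (Suc i) \<and> C1_between \<alpha> (s i) (s (Suc i))"
    unfolding piecewise_C1_curve_pieces by blast
  have "C1_between \<alpha> u v" if uv: "0 \<le> u" "u < v" "v \<le> 1" "{u<..<v} \<inter> s ` {..N} = {}" for u v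
  proof -
    have "s 0 \<le> u" "u < s N" using s(1,2) uv by auto
    then obtain i where i: "i < N" "s i \<le> u" "u < s (Suc i)"
      by (rule partition_index)
    have "s (Suc i) \<notin> {u<..<v}" using uv(4) \<open>i < N\<close> by auto
    then have "v \<le> s (Suc i)" using i by auto
    then show ?thesis using C1_between_subset s(3)[OF i(1)] i(2) by blast
  qed
  then show "\<exists>P. finite P \<and> (\<forall>u v. 0 \<le> u \<and> u < v \<and> v \<le> 1 \<and> {u<..<v} \<inter> P = {} \<longrightarrow> C1_between \<alpha> u v)"
    by (intro exI[of _ "s ` {..N}"]) auto
next
  assume "\<exists>P. finite P \<and> (\<forall>u v. 0 \<le> u \<and> u < v \<and> v \<le> 1 \<and> {u<..<v} \<inter> P = {} \<longrightarrow> C1_between \<alpha> u v)"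
  then obtain P where P: "finite P" 
      "\<And>u v. \<lbrakk>0 \<le> u; u < v; v \<le> 1; {u<..<v} \<inter> P = {}\<rbrakk> \<Longrightarrow> C1_between \<alpha> u v"
    by blast
  define Q where "Q = insert 0 (insert 1 (P \<inter> {0..1}))"
  define xs where "xs = sorted_list_of_set Q"
  have Q: "finite Q" "Q \<subseteq> {0..1}" "0 \<in> Q" "1 \<in> Q" using P(1) by (auto simp: Q_def)
  have set: "set xs = Q" using Q by (simp add: xs_def)
  have less: "xs ! i < xs ! j" if "i < j" "j < length xs" for i j
    using that strict_sorted_list_of_set[of Q] sorted_wrt_nth_less[of "(<)" xs i j] by (simp add: xs_def)
  have less_iff: "xs ! i < xs ! j \<Longrightarrow> i < j" if "i < length xs" "j < length xs" for i j
    using less[of j i] that by (metis linorder_neqE_nat order_less_asym order_less_irrefl)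
  have mem: "xs ! i \<in> Q" if "i < length xs" for i using that set nth_mem by blast
  obtain a where a: "a < length xs" "xs ! a = 0" using Q(3) set by (metis in_set_conv_nth)
  obtain b where b: "b < length xs" "xs ! b = 1" using Q(4) set by (metis in_set_conv_nth)
  have "a = 0"
  proof (rule ccontr)
    assume "a \<noteq> 0"
    then have "xs ! 0 < 0" "xs ! 0 \<in> Q" using less[of 0 a] a mem[of 0] by fastforce+
    then show False using Q(2) by auto
  qed
  moreover have "b = length xs - 1"
  proof (rule ccontr)
    assume "b \<noteq> length xs - 1"
    then have "xs ! (length xs - 1) > 1" "xs ! (length xs - 1) \<in> Q"
      using less[of b "length xs - 1"] b mem[of "length xs - 1"] by fastforce+
    then show False using Q(2) by auto
  qed
  moreover have "xs ! i < xs ! Suc i \<and> C1_between \<alpha> (xs ! i) (xs ! Suc i)" if "i < length xs - 1" for i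
  proof -
    have lt: "xs ! i < xs ! Suc i" using less that by simp
    have "{xs ! i<..<xs ! Suc i} \<inter> Q = {}"
    proof (rule ccontr)
      assume "{xs ! i<..<xs ! Suc i} \<inter> Q \<noteq> {}"
      then obtain q where "q \<in> set xs" "xs ! i < q" "q < xs ! Suc i"
        using set by auto
      then obtain j where "j < length xs" "xs ! i < xs ! j" "xs ! j < xs ! Suc i"
        by (metis in_set_conv_nth)
      moreover have "i < length xs" "Suc i < length xs" using that by linarith+
      ultimately have "i < j" "j < Suc i" using less_iff by blast+
      then show False by simp
    qed
    moreover have "xs ! i \<in> Q" "xs ! Suc i \<in> Q" using that by (auto intro!: mem)
    ultimately have "C1_between \<alpha> (xs ! i) (xs ! Suc i)"
      using lt Q(2) by (intro P(2)) (auto simp: Q_def)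
    then show ?thesis using lt by blast
  qed
  ultimately show "piecewise_C1_curve \<alpha>"
    unfolding piecewise_C1_curve_pieces using a b
    by (intro exI[of _ "length xs - 1"] exI[of _ "\<lambda>i. xs ! i"]) auto
qed

lemma C1_between_imp_piecewise: "C1_between \<alpha> 0 1 \<Longrightarrow> piecewise_C1_curve \<alpha>"
  unfolding piecewise_C1_curve_iff_breaks
  by (intro exI[of _ "{}"]) (auto intro: C1_between_subset)

lemma piecewise_C1_curve_affine_image:
  assumes "piecewise_C1_curve \<alpha>" "bounded_linear T"
  shows "piecewise_C1_curve (\<lambda>t. T (\<alpha> t) + c)"
proof -
  have "C1_between (\<lambda>t. T (\<alpha> t) + c) u v" if \<alpha>: "C1_between \<alpha> u v" for u v
  proof -
    obtain D where D: "continuous_on {u..v} D"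
        "\<And>t. t \<in> {u..v} \<Longrightarrow> (\<alpha> has_vector_derivative D t) (at t within {u..v})"
      using \<alpha> unfolding C1_between_def by blast
    have "((\<lambda>t. T (\<alpha> t) + c) has_vector_derivative T (D t)) (at t within {u..v})"
      if "t \<in> {u..v}" for t
      using bounded_linear.has_vector_derivative[OF assms(2) D(2)[OF that]]
      by (auto intro!: derivative_eq_intros)
    moreover have "continuous_on {u..v} (\<lambda>t. T (D t))"
      by (rule bounded_linear.continuous_on[OF assms(2) D(1)])
    ultimately show ?thesis unfolding C1_between_def by blast
  qed
  then show ?thesis
    using assms(1) unfolding piecewise_C1_curve_iff_breaks by (elim ex_forward) simp
qed

lemma C1_between_reverse:
  assumes "C1_between \<alpha> (1 - v) (1 - u)"
  shows "C1_between (\<lambda>t. \<alpha> (1 - t)) u v"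
proof -
  obtain D where D: "continuous_on {1-v..1-u} D"
      "\<And>t. t \<in> {1-v..1-u} \<Longrightarrow> (\<alpha> has_vector_derivative D t) (at t within {1-v..1-u})"
    using assms unfolding C1_between_def by blast
  have im: "(\<lambda>t. 1 - t) ` {u..v} = {1-v..1-u}" by simp
  have "((\<lambda>t. \<alpha> (1 - t)) has_vector_derivative - D (1 - t)) (at t within {u..v})"
    if t: "t \<in> {u..v}" for t
  proof -
    have "((\<lambda>t. 1 - t) has_vector_derivative -1) (at t within {u..v})"
      by (auto intro!: derivative_eq_intros)
    from vector_diff_chain_within[OF this, of \<alpha> "D (1 - t)"] show ?thesis
      using D(2)[of "1 - t"] t by (simp add: im o_def)
  qed
  moreover have "continuous_on {u..v} (\<lambda>t. - D (1 - t))"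
    by (intro continuous_intros continuous_on_compose2[OF D(1)]) auto
  ultimately show ?thesis unfolding C1_between_def by (intro exI[of _ "\<lambda>t. - D (1 - t)"]) auto
qed

text \<open>
  Reversal is what makes the distance symmetric.
\<close>

lemma piecewise_C1_curve_reverse:
  assumes "piecewise_C1_curve \<alpha>"
  shows "piecewise_C1_curve (\<lambda>t. \<alpha> (1 - t))"
proof -
  obtain P where P: "finite P"
      "\<And>u v. \<lbrakk>0 \<le> u; u < v; v \<le> 1; {u<..<v} \<inter> P = {}\<rbrakk> \<Longrightarrow> C1_between \<alpha> u v"
    using assms unfolding piecewise_C1_curve_iff_breaks by blast
  have "C1_between (\<lambda>t. \<alpha> (1 - t)) u v"
    if "0 \<le> u" "u < v" "v \<le> 1" "{u<..<v} \<inter> (\<lambda>t. 1 - t) ` P = {}" for u v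
  proof (rule C1_between_reverse, rule P(2))
    show "{1 - v<..<1 - u} \<inter> P = {}"
    proof (rule ccontr)
      assume "{1 - v<..<1 - u} \<inter> P \<noteq> {}"
      then obtain t where "t \<in> P" "1 - v < t" "t < 1 - u" by auto
      then have "1 - t \<in> {u<..<v} \<inter> (\<lambda>t. 1 - t) ` P" by auto
      then show False using that(4) by blast
    qed
  qed (use that in auto)
  then show ?thesis
    unfolding piecewise_C1_curve_iff_breaks using P(1)
    by (intro exI[of _ "(\<lambda>t. 1 - t) ` P"]) auto
qed

text \<open>
  The part of \<open>\<alpha>\<close> over \<open>[a, b]\<close>, extended by constants to the same parameter interval. Since resting costs
  no length, this replaces a reparametrisation of the part and so avoids any change of variables.
\<close>

definition stop_outside :: "real \<Rightarrow> real \<Rightarrow> (real \<Rightarrow> 'a) \<Rightarrow> real \<Rightarrow> 'a" where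
  "stop_outside a b \<alpha> t = \<alpha> (max a (min b t))"

lemma piecewise_C1_curve_stop_outside:
  assumes "piecewise_C1_curve \<alpha>" "a \<le> b"
  shows "piecewise_C1_curve (stop_outside a b \<alpha>)"
proof -
  obtain P where P: "finite P"
      "\<And>u v. \<lbrakk>0 \<le> u; u < v; v \<le> 1; {u<..<v} \<inter> P = {}\<rbrakk> \<Longrightarrow> C1_between \<alpha> u v"
    using assms unfolding piecewise_C1_curve_iff_breaks by blast
  have const: "C1_between (\<lambda>t. c) u v" for c :: 'a and u v
    unfolding C1_between_def by (intro exI[of _ "\<lambda>t. 0"]) auto
  have "C1_between (stop_outside a b \<alpha>) u v"
    if uv: "0 \<le> u" "u < v" "v \<le> 1" "{u<..<v} \<inter> insert a (insert b P) = {}" for u v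
  proof -
    consider "v \<le> a" | "b \<le> u" | "a \<le> u" "v \<le> b"
      using uv(2,4) by fastforce
    then show ?thesis
    proof cases
      case 1
      then have "max a (min b t) = a" if "t \<in> {u..v}" for t
        using that by (auto simp: max_def min_def)
      then show ?thesis
        by (intro C1_between_cong[OF const[of "\<alpha> a"]]) (simp add: stop_outside_def)
    next
      case 2
      then have "max a (min b t) = b" if "t \<in> {u..v}" for t
        using that assms(2) by (auto simp: max_def min_def)
      then show ?thesis
        by (intro C1_between_cong[OF const[of "\<alpha> b"]]) (simp add: stop_outside_def)
    next
      case 3
      then have "max a (min b t) = t" if "t \<in> {u..v}" for t
        using that by (auto simp: max_def min_def)
      then have "\<alpha> t = stop_outside a b \<alpha> t" if "t \<in> {u..v}" for t
        using that by (simp add: stop_outside_def)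
      moreover have "C1_between \<alpha> u v"
        using uv by (intro P(2)) auto
      ultimately show ?thesis
        by (metis C1_between_cong)
    qed
  qed
  then show ?thesis
    unfolding piecewise_C1_curve_iff_breaks using P(1)
    by (intro exI[of _ "insert a (insert b P)"]) auto
qed

lemma C1_between_interior:
  assumes "C1_between \<alpha> u v" "t \<in> {u<..<v}"
  shows "(\<alpha> has_vector_derivative vector_derivative \<alpha> (at t)) (at t)"
    and "isCont (\<lambda>t. vector_derivative \<alpha> (at t)) t"
proof -
  obtain D where D: "continuous_on {u..v} D"
      "\<And>t. t \<in> {u..v} \<Longrightarrow> (\<alpha> has_vector_derivative D t) (at t within {u..v})"
    using assms(1) unfolding C1_between_def by blast
  have der: "(\<alpha> has_vector_derivative D t) (at t)" if "t \<in> {u<..<v}" for t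
    using D(2)[of t] that by (simp add: at_within_Icc_at)
  then have vd: "vector_derivative \<alpha> (at t) = D t" if "t \<in> {u<..<v}" for t
    using that vector_derivative_at by blast
  show "(\<alpha> has_vector_derivative vector_derivative \<alpha> (at t)) (at t)"
    using der vd assms(2) by simp
  have "continuous_on {u<..<v} D"
    by (rule continuous_on_subset[OF D(1)]) auto
  then have "continuous_on {u<..<v} (\<lambda>t. vector_derivative \<alpha> (at t))"
    by (subst continuous_on_cong[OF refl vd]) auto
  then show "isCont (\<lambda>t. vector_derivative \<alpha> (at t)) t"
    using assms(2) by (simp add: continuous_on_eq_continuous_at)
qed

text \<open>
  The data about a curve that hold off finitely many parameters; the finitely many exceptions are
  invisible to the length integral.
\<close>

lemma piecewise_C1_curve_obtain:
  fixes \<alpha> :: "real \<Rightarrow> 'a::real_normed_vector"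
  assumes "piecewise_C1_curve \<alpha>"
  obtains P B where "finite P" "continuous_on {0..1} \<alpha>"
    "\<And>t. t \<in> {0<..<1} - P \<Longrightarrow> (\<alpha> has_vector_derivative vector_derivative \<alpha> (at t)) (at t)"
    "continuous_on ({0<..<1} - P) (\<lambda>t. vector_derivative \<alpha> (at t))"
    "\<And>t. t \<in> {0<..<1} - P \<Longrightarrow> norm (vector_derivative \<alpha> (at t)) \<le> B"
proof -
  obtain N s where s: "s 0 = 0" "s (N::nat) = 1"
      "\<And>i. i < N \<Longrightarrow> s i < s (Suc i)" "\<And>i. i < N \<Longrightarrow> C1_between \<alpha> (s i) (s (Suc i))"
    using assms unfolding piecewise_C1_curve_pieces by blast
  have "\<exists>D. continuous_on {s i..s (Suc i)} D \<and>
     (\<forall>t\<in>{s i..s (Suc i)}. (\<alpha> has_vector_derivative D t) (at t within {s i..s (Suc i)}))" if "i < N" for i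
    using s(4)[OF that] by (simp add: C1_between_def)
  then obtain D where D: "\<And>i. i < N \<Longrightarrow> continuous_on {s i..s (Suc i)} (D i)"
     "\<And>i t. i < N \<Longrightarrow> t\<in>{s i..s (Suc i)} \<Longrightarrow> (\<alpha> has_vector_derivative D i t) (at t within {s i..s (Suc i)})"
    by metis
  have "\<exists>B. \<forall>t\<in>{s i..s (Suc i)}. norm (D i t) \<le> B" if "i < N" for i
    using compact_imp_bounded[OF compact_continuous_image[OF D(1)[OF that] compact_Icc]]
    by (auto simp: bounded_iff)
  then obtain B where B: "\<And>i t. i < N \<Longrightarrow> t\<in>{s i..s (Suc i)} \<Longrightarrow> norm (D i t) \<le> B i"
    by metis
  define P where "P = s ` {..N}"
  have piece: "\<exists>i<N. t \<in> {s i<..<s (Suc i)}" if "t \<in> {0<..<1} - P" for t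
  proof -
    have "s 0 \<le> t" "t < s N" using s(1,2) that by auto
    then obtain i where i: "i < N" "s i \<le> t" "t < s (Suc i)"
      by (rule partition_index)
    then have "t \<noteq> s i" using that by (auto simp: P_def)
    then show ?thesis using i by force
  qed
  show ?thesis
  proof (rule that[of P "\<Sum>i<N. \<bar>B i\<bar>"])
    show "finite P" by (simp add: P_def)
    have "continuous_on {s i..s (Suc i)} \<alpha>" if "i < N" for i
      using D(2)[OF that] has_vector_derivative_continuous continuous_on_eq_continuous_within by blast
    then have "continuous_on (\<Union>i\<in>{..<N}. {s i..s (Suc i)}) \<alpha>"
      by (intro continuous_on_closed_Union) auto
    moreover have "{0..1} \<subseteq> (\<Union>i\<in>{..<N}. {s i..s (Suc i)})"
    proof
      fix t :: real assume t: "t \<in> {0..1}"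
      show "t \<in> (\<Union>i\<in>{..<N}. {s i..s (Suc i)})"
      proof (cases "t = 1")
        case True
        have "N \<noteq> 0" using s(1,2) by (metis zero_neq_one)
        then have "N - 1 < N" "Suc (N - 1) = N" by auto
        then have "t \<in> {s (N - 1)..s (Suc (N - 1))}" using s(2) s(3)[of "N - 1"] True by auto
        then show ?thesis using \<open>N - 1 < N\<close> by blast
      next
        case False
        then have "s 0 \<le> t" "t < s N" using s(1,2) t by auto
        then obtain i where "i < N" "s i \<le> t" "t < s (Suc i)"
          by (rule partition_index)
        then show ?thesis by force
      qed
    qed
    ultimately show "continuous_on {0..1} \<alpha>" by (rule continuous_on_subset)
    fix t
    show "(\<alpha> has_vector_derivative vector_derivative \<alpha> (at t)) (at t)" if "t \<in> {0<..<1} - P" for t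
      using piece[OF that] C1_between_interior(1) s(4) by blast
    have "isCont (\<lambda>t. vector_derivative \<alpha> (at t)) t" if "t \<in> {0<..<1} - P" for t
      using piece[OF that] C1_between_interior(2) s(4) by blast
    then show "continuous_on ({0<..<1} - P) (\<lambda>t. vector_derivative \<alpha> (at t))"
      by (simp add: continuous_at_imp_continuous_on)
    show "norm (vector_derivative \<alpha> (at t)) \<le> (\<Sum>i<N. \<bar>B i\<bar>)" if "t \<in> {0<..<1} - P" for t
    proof -
      obtain i where i: "i < N" "t \<in> {s i<..<s (Suc i)}" using piece[OF \<open>t \<in> {0<..<1} - P\<close>] by blast
      have "(\<alpha> has_vector_derivative D i t) (at t)"
        using D(2)[OF i(1), of t] i(2) by (simp add: at_within_Icc_at)
      then have "norm (vector_derivative \<alpha> (at t)) = norm (D i t)"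
        by (simp add: vector_derivative_at)
      also have "\<dots> \<le> \<bar>B i\<bar>" using B[OF i(1), of t] i(2) by force
      also have "\<dots> \<le> (\<Sum>i<N. \<bar>B i\<bar>)" using i(1) by (intro member_le_sum) auto
      finally show ?thesis .
    qed
  qed
qed

section \<open>Integrals of functions that need not be measurable\<close>

text \<open>
  The integral of a function that is not known to be measurable is its lower integral, and the supremum
  defining it is attained by a measurable function. The additivity and reflection laws below, which are
  applied to the Kobayashi metric along a curve, follow by replacing the integrand by such a minorant.
\<close>

lemma nn_integral_obtain_measurable_minorant:
  obtains g where "g \<in> borel_measurable M" "\<And>x. g x \<le> f x" "(\<integral>\<^sup>+x. g x \<partial>M) = (\<integral>\<^sup>+x. f x \<partial>M)"
proof -
  let ?S = "{g. simple_function M g \<and> g \<le> f}"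
  have "(\<lambda>x. 0) \<in> ?S" by (auto simp: le_fun_def)
  then have "?S \<noteq> {}" by blast
  from ennreal_SUP_countable_SUP[OF this, of "integral\<^sup>S M"]
  obtain F :: "nat \<Rightarrow> ennreal" where F: "range F \<subseteq> integral\<^sup>S M ` ?S" "Sup (integral\<^sup>S M ` ?S) = Sup (range F)"
    by blast
  have sup: "(\<integral>\<^sup>+x. f x \<partial>M) = Sup (range F)"
    unfolding nn_integral_def using F(2) .
  have "\<forall>n. \<exists>g\<in>?S. F n = integral\<^sup>S M g" using F(1) by blast
  then obtain u where u: "\<And>n. u n \<in> ?S" "\<And>n. F n = integral\<^sup>S M (u n)" by metis
  define g where "g = (\<lambda>x. SUP n. u n x)"
  have [measurable]: "u n \<in> borel_measurable M" for n
    using u(1) by (auto intro: borel_measurable_simple_function)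
  have meas: "g \<in> borel_measurable M" unfolding g_def by measurable
  have le: "g x \<le> f x" for x
    unfolding g_def using u(1) by (auto intro!: SUP_least simp: le_fun_def)
  have "F n \<le> (\<integral>\<^sup>+x. g x \<partial>M)" for n
  proof -
    have "F n = (\<integral>\<^sup>+x. u n x \<partial>M)" using u by (simp add: nn_integral_eq_simple_integral)
    also have "\<dots> \<le> (\<integral>\<^sup>+x. g x \<partial>M)"
      unfolding g_def by (intro nn_integral_mono SUP_upper) auto
    finally show ?thesis .
  qed
  then have "(\<integral>\<^sup>+x. f x \<partial>M) \<le> (\<integral>\<^sup>+x. g x \<partial>M)" unfolding sup by (auto intro!: SUP_least)
  moreover have "(\<integral>\<^sup>+x. g x \<partial>M) \<le> (\<integral>\<^sup>+x. f x \<partial>M)" using le by (intro nn_integral_mono) auto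
  ultimately show ?thesis using that[OF meas le] by auto
qed

lemma nn_integral_disjoint_pair_nonmeasurable:
  fixes f :: "'a \<Rightarrow> ennreal"
  assumes [measurable]: "B \<in> sets M" "C \<in> sets M" and disj: "B \<inter> C = {}"
  shows "(\<integral>\<^sup>+x \<in> B \<union> C. f x \<partial>M) = (\<integral>\<^sup>+x \<in> B. f x \<partial>M) + (\<integral>\<^sup>+x \<in> C. f x \<partial>M)"
proof (rule antisym)
  obtain g where [measurable]: "g \<in> borel_measurable M"
    and g: "\<And>x. g x \<le> f x * indicator (B \<union> C) x"
      "(\<integral>\<^sup>+x. g x \<partial>M) = (\<integral>\<^sup>+x \<in> B \<union> C. f x \<partial>M)"
    using nn_integral_obtain_measurable_minorant[of M "\<lambda>x. f x * indicator (B \<union> C) x"] by blast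
  have "g x = g x * indicator (B \<union> C) x" for x
    using g(1)[of x] by (auto split: split_indicator)
  then have "(\<integral>\<^sup>+x. g x \<partial>M) = (\<integral>\<^sup>+x \<in> B \<union> C. g x \<partial>M)"
    by (intro nn_integral_cong) auto
  also have "\<dots> = (\<integral>\<^sup>+x \<in> B. g x \<partial>M) + (\<integral>\<^sup>+x \<in> C. g x \<partial>M)"
    by (rule nn_integral_disjoint_pair) (use disj in auto)
  also have "\<dots> \<le> (\<integral>\<^sup>+x \<in> B. f x \<partial>M) + (\<integral>\<^sup>+x \<in> C. f x \<partial>M)"
  proof -
    have "g x \<le> f x" if "x \<in> B \<union> C" for x
      using g(1)[of x] that by simp
    then show ?thesis
      by (intro add_mono nn_integral_mono) (auto split: split_indicator)
  qed
  finally show "(\<integral>\<^sup>+x \<in> B \<union> C. f x \<partial>M) \<le> (\<integral>\<^sup>+x \<in> B. f x \<partial>M) + (\<integral>\<^sup>+x \<in> C. f x \<partial>M)"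
    using g(2) by simp
next
  obtain g where [measurable]: "g \<in> borel_measurable M"
    and g: "\<And>x. g x \<le> f x * indicator B x" "(\<integral>\<^sup>+x. g x \<partial>M) = (\<integral>\<^sup>+x \<in> B. f x \<partial>M)"
    using nn_integral_obtain_measurable_minorant[of M "\<lambda>x. f x * indicator B x"] by blast
  obtain h where [measurable]: "h \<in> borel_measurable M"
    and h: "\<And>x. h x \<le> f x * indicator C x" "(\<integral>\<^sup>+x. h x \<partial>M) = (\<integral>\<^sup>+x \<in> C. f x \<partial>M)"
    using nn_integral_obtain_measurable_minorant[of M "\<lambda>x. f x * indicator C x"] by blast
  have "g x + h x \<le> f x * indicator (B \<union> C) x" for x
  proof -
    have "g x + h x \<le> f x * indicator B x + f x * indicator C x"
      using g(1) h(1) by (rule add_mono)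
    also have "\<dots> = f x * indicator (B \<union> C) x"
      using disj by (auto split: split_indicator)
    finally show ?thesis .
  qed
  then have "(\<integral>\<^sup>+x. g x + h x \<partial>M) \<le> (\<integral>\<^sup>+x \<in> B \<union> C. f x \<partial>M)"
    by (intro nn_integral_mono) auto
  then show "(\<integral>\<^sup>+x \<in> B. f x \<partial>M) + (\<integral>\<^sup>+x \<in> C. f x \<partial>M) \<le> (\<integral>\<^sup>+x \<in> B \<union> C. f x \<partial>M)"
    by (simp add: nn_integral_add g(2) h(2))
qed

lemma nn_integral_reflect_le:
  fixes f :: "real \<Rightarrow> ennreal"
  shows "(\<integral>\<^sup>+t. f t \<partial>lborel) \<le> (\<integral>\<^sup>+t. f (1 - t) \<partial>lborel)"
proof -
  obtain g where g: "g \<in> borel_measurable lborel" "\<And>x. g x \<le> f x"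
      "(\<integral>\<^sup>+x. g x \<partial>lborel) = (\<integral>\<^sup>+x. f x \<partial>lborel)"
    using nn_integral_obtain_measurable_minorant[of lborel f] by blast
  have "(\<integral>\<^sup>+x. g x \<partial>lborel) = (\<integral>\<^sup>+x. g (1 - x) \<partial>lborel)"
    using nn_integral_real_affine[of g "-1" 1] g(1) by simp
  also have "\<dots> \<le> (\<integral>\<^sup>+x. f (1 - x) \<partial>lborel)" using g(2) by (intro nn_integral_mono) auto
  finally show ?thesis using g(3) by simp
qed

section \<open>Lengths of curves\<close>

lemma nn_integral_mono_off_finite:
  fixes f g :: "real \<Rightarrow> ennreal"
  assumes "finite P" "\<And>t. t \<in> {0<..<1} - P \<Longrightarrow> f t \<le> g t"
  shows "(\<integral>\<^sup>+t\<in>{0..1}. f t \<partial>lborel) \<le> (\<integral>\<^sup>+t\<in>{0..1}. g t \<partial>lborel)"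
proof (rule nn_integral_mono_AE)
  have "AE t in lborel. t \<notin> insert 0 (insert 1 P)"
    by (rule AE_not_in) (use assms(1) in \<open>auto intro: finite_imp_null_set_lborel\<close>)
  then show "AE t in lborel. f t * indicator {0..1} t \<le> g t * indicator {0..1} t"
    by (rule eventually_mono) (auto simp: assms(2) split: split_indicator)
qed

lemma nn_integral_le_const_off_finite:
  fixes f :: "real \<Rightarrow> ennreal"
  assumes "finite P" "\<And>t. t \<in> {0<..<1} - P \<Longrightarrow> f t \<le> c"
  shows "(\<integral>\<^sup>+t\<in>{0..1}. f t \<partial>lborel) \<le> c"
  using nn_integral_mono_off_finite[of P f "\<lambda>_. c"] assms by (simp add: nn_integral_cmult_indicator)

text \<open>
  The compact image of the curve has a positive distance to the complement of \<open>G\<close>, and the speed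
  of a piecewise C1 curve is bounded.
\<close>

lemma kobayashi_metric_bounded_on_curve:
  assumes "open G" "\<alpha> \<in> curves_joining G p q"
  obtains P C where "finite P" "0 \<le> C"
    "\<And>t. t \<in> {0<..<1} - P \<Longrightarrow> kobayashi_metric G (\<alpha> t) (vector_derivative \<alpha> (at t)) \<le> C"
proof -
  have \<alpha>: "piecewise_C1_curve \<alpha>" "\<alpha> ` {0..1} \<subseteq> G" using assms(2) by (auto simp: curves_joining_def)
  obtain P B where P: "finite P" "continuous_on {0..1} \<alpha>"
    and B: "\<And>t. t \<in> {0<..<1} - P \<Longrightarrow> norm (vector_derivative \<alpha> (at t)) \<le> B"
    using piecewise_C1_curve_obtain[OF \<alpha>(1)] by metis
  have "compact (\<alpha> ` {0..1})" using P(2) by (intro compact_continuous_image) auto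
  then obtain e where e: "e > 0" "(\<Union>x\<in>\<alpha> ` {0..1}. ball x e) \<subseteq> G"
    using compact_subset_open_imp_ball_epsilon_subset[OF _ assms(1) \<alpha>(2)] by metis
  show ?thesis
  proof (rule that[of P "\<bar>B\<bar> / e"])
    fix t assume t: "t \<in> {0<..<1} - P"
    then have "ball (\<alpha> t) e \<subseteq> G" using e(2) by force
    then have "kobayashi_metric G (\<alpha> t) (vector_derivative \<alpha> (at t)) \<le> norm (vector_derivative \<alpha> (at t)) / e"
      using e(1) by (rule kobayashi_metric_le_ball)
    also have "\<dots> \<le> \<bar>B\<bar> / e"
      using B[OF t] e(1) by (intro divide_right_mono) auto
    finally show "kobayashi_metric G (\<alpha> t) (vector_derivative \<alpha> (at t)) \<le> \<bar>B\<bar> / e" .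
  qed (use P e in auto)
qed

lemma kobayashi_length_finite:
  assumes "open G" "\<alpha> \<in> curves_joining G p q"
  shows "kobayashi_length G \<alpha> < \<infinity>"
proof -
  obtain P C where PC: "finite P" "0 \<le> C"
    "\<And>t. t \<in> {0<..<1} - P \<Longrightarrow> kobayashi_metric G (\<alpha> t) (vector_derivative \<alpha> (at t)) \<le> C"
    using kobayashi_metric_bounded_on_curve[OF assms] by metis
  have "kobayashi_length G \<alpha> \<le> ennreal C"
    unfolding kobayashi_length_def
    by (rule nn_integral_le_const_off_finite[OF PC(1)]) (use PC in \<open>auto intro: ennreal_leI\<close>)
  then show ?thesis by (simp add: le_less_trans)
qed

lemma kobayashi_length_matrix:
  fixes A :: "complex^'m^'k"
  assumes "open G" "\<alpha> \<in> curves_joining G p q" and T: "\<And>x. x \<in> G \<Longrightarrow> A *v x + c \<in> H"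
  shows "(\<lambda>t. A *v \<alpha> t + c) \<in> curves_joining H (A *v p + c) (A *v q + c)"
    and "kobayashi_length H (\<lambda>t. A *v \<alpha> t + c) \<le> kobayashi_length G \<alpha>"
proof -
  have \<alpha>: "piecewise_C1_curve \<alpha>" "\<alpha> ` {0..1} \<subseteq> G" "\<alpha> 0 = p" "\<alpha> 1 = q"
    using assms(2) by (auto simp: curves_joining_def)
  show "(\<lambda>t. A *v \<alpha> t + c) \<in> curves_joining H (A *v p + c) (A *v q + c)"
    using \<alpha> T by (auto simp: curves_joining_def intro!: piecewise_C1_curve_affine_image[of \<alpha> "(*v) A"])
  obtain P where P: "finite P"
    "\<And>t. t \<in> {0<..<1} - P \<Longrightarrow> (\<alpha> has_vector_derivative vector_derivative \<alpha> (at t)) (at t)"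
    using piecewise_C1_curve_obtain[OF \<alpha>(1)] by metis
  show "kobayashi_length H (\<lambda>t. A *v \<alpha> t + c) \<le> kobayashi_length G \<alpha>"
    unfolding kobayashi_length_def
  proof (rule nn_integral_mono_off_finite[OF P(1)], rule ennreal_leI)
    fix t assume t: "t \<in> {0<..<1} - P"
    have "((\<lambda>t. A *v \<alpha> t + c) has_vector_derivative A *v vector_derivative \<alpha> (at t)) (at t)"
      using bounded_linear.has_vector_derivative[OF matrix_vector_mul_bounded_linear P(2)[OF t], of A]
      by (auto intro!: derivative_eq_intros)
    then have "vector_derivative (\<lambda>t. A *v \<alpha> t + c) (at t) = A *v vector_derivative \<alpha> (at t)"
      by (rule vector_derivative_at)
    moreover have "\<alpha> t \<in> G" using \<alpha>(2) t by auto
    ultimately show "kobayashi_metric H (A *v \<alpha> t + c) (vector_derivative (\<lambda>t. A *v \<alpha> t + c) (at t))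
        \<le> kobayashi_metric G (\<alpha> t) (vector_derivative \<alpha> (at t))"
      using kobayashi_metric_matrix_le[OF assms(1) _ T] by simp
  qed
qed

text \<open>
  Reversing twice gives back the curve, so the inequality is in fact an equality.
\<close>

lemma kobayashi_length_reverse:
  assumes "\<alpha> \<in> curves_joining G p q"
  shows "(\<lambda>t. \<alpha> (1 - t)) \<in> curves_joining G q p"
    and "kobayashi_length G (\<lambda>t. \<alpha> (1 - t)) \<le> kobayashi_length G \<alpha>"
proof -
  have \<alpha>: "piecewise_C1_curve \<alpha>" "\<alpha> ` {0..1} \<subseteq> G" "\<alpha> 0 = p" "\<alpha> 1 = q"
    using assms by (auto simp: curves_joining_def)
  show "(\<lambda>t. \<alpha> (1 - t)) \<in> curves_joining G q p"
    using \<alpha> by (auto simp: curves_joining_def intro!: piecewise_C1_curve_reverse)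
  obtain P where P: "finite P"
    "\<And>t. t \<in> {0<..<1} - P \<Longrightarrow> (\<alpha> has_vector_derivative vector_derivative \<alpha> (at t)) (at t)"
    using piecewise_C1_curve_obtain[OF \<alpha>(1)] by metis
  define F where "F t = ennreal (kobayashi_metric G (\<alpha> t) (vector_derivative \<alpha> (at t))) * indicator {0..1} t" for t
  have "kobayashi_length G (\<lambda>t. \<alpha> (1 - t)) \<le>
     (\<integral>\<^sup>+t\<in>{0..1}. ennreal (kobayashi_metric G (\<alpha> (1 - t)) (vector_derivative \<alpha> (at (1 - t)))) \<partial>lborel)"
    unfolding kobayashi_length_def
  proof (rule nn_integral_mono_off_finite[of "(\<lambda>t. 1 - t) ` P"])
    fix t :: real assume "t \<in> {0<..<1} - (\<lambda>t. 1 - t) ` P"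
    then have t: "1 - t \<in> {0<..<1} - P" by (auto simp: image_iff)
    have "((\<lambda>t. 1 - t) has_vector_derivative -1) (at t)"
      by (auto intro!: derivative_eq_intros)
    from vector_diff_chain_at[OF this, of \<alpha>] P(2)[OF t]
    have "vector_derivative (\<lambda>t. \<alpha> (1 - t)) (at t) = - vector_derivative \<alpha> (at (1 - t))"
      by (intro vector_derivative_at) (auto simp: o_def)
    then show "ennreal (kobayashi_metric G (\<alpha> (1 - t)) (vector_derivative (\<lambda>t. \<alpha> (1 - t)) (at t)))
      \<le> ennreal (kobayashi_metric G (\<alpha> (1 - t)) (vector_derivative \<alpha> (at (1 - t))))"
      by (simp add: kobayashi_metric_minus)
  qed (use P in auto)
  also have "\<dots> = (\<integral>\<^sup>+t. F (1 - t) \<partial>lborel)"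
    unfolding F_def by (intro nn_integral_cong) (auto split: split_indicator)
  also have "\<dots> \<le> (\<integral>\<^sup>+t. F (1 - (1 - t)) \<partial>lborel)"
    by (rule nn_integral_reflect_le)
  also have "\<dots> = kobayashi_length G \<alpha>" by (simp add: F_def kobayashi_length_def)
  finally show "kobayashi_length G (\<lambda>t. \<alpha> (1 - t)) \<le> kobayashi_length G \<alpha>" .
qed

text \<open>
  Integrating the infinitesimal bound: along the curve, \<open>ln \<rho> / 2\<close> has a measurable derivative that is
  dominated by the metric.
\<close>

lemma kobayashi_length_ge_pluriharmonic:
  assumes "open G" "\<alpha> \<in> curves_joining G p q"
    and \<rho>: "\<And>x. x \<in> G \<Longrightarrow> (\<rho> has_derivative \<rho>' x) (at x)"
    and cont: "continuous_on (G \<times> UNIV) (\<lambda>(x, X). \<rho>' x X)"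
    and h: "\<And>f. analytic_disc G f \<Longrightarrow> \<exists>h. h holomorphic_on ball 0 1 \<and>
               (\<forall>\<zeta>\<in>ball 0 1. Re (h \<zeta>) = \<rho> (f \<zeta>))"
    and pos: "\<And>x. x \<in> G \<Longrightarrow> \<rho> x > 0"
  shows "ennreal (\<bar>ln (\<rho> q) - ln (\<rho> p)\<bar> / 2) \<le> kobayashi_length G \<alpha>"
proof -
  have \<alpha>: "piecewise_C1_curve \<alpha>" "\<alpha> ` {0..1} \<subseteq> G" "\<alpha> 0 = p" "\<alpha> 1 = q"
    using assms(2) by (auto simp: curves_joining_def)
  have G: "\<alpha> t \<in> G" if "t \<in> {0..1}" for t using \<alpha>(2) that by auto
  obtain P where P: "finite P" "continuous_on {0..1} \<alpha>"
    "\<And>t. t \<in> {0<..<1} - P \<Longrightarrow> (\<alpha> has_vector_derivative vector_derivative \<alpha> (at t)) (at t)"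
    "continuous_on ({0<..<1} - P) (\<lambda>t. vector_derivative \<alpha> (at t))"
    using piecewise_C1_curve_obtain[OF \<alpha>(1)] by metis
  define I where "I = {0<..<1} - P"
  have I: "t \<in> {0..1}" if "t \<in> I" for t using that by (auto simp: I_def)
  define g where "g t = ln (\<rho> (\<alpha> t)) / 2" for t
  define g' where "g' t = indicator I t *\<^sub>R (\<rho>' (\<alpha> t) (vector_derivative \<alpha> (at t)) / (2 * \<rho> (\<alpha> t)))" for t
  have \<rho>cont: "continuous_on G \<rho>"
    by (rule has_derivative_continuous_on) (use \<rho> in \<open>auto intro: has_derivative_at_withinI\<close>)
  have g: "(g has_vector_derivative g' t) (at t)" if t: "t \<in> I" for t
  proof -
    have "((\<lambda>t. \<rho> (\<alpha> t)) has_derivative (\<lambda>s. \<rho>' (\<alpha> t) (s *\<^sub>R vector_derivative \<alpha> (at t)))) (at t)"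
      using has_derivative_compose[of \<alpha> _ t UNIV \<rho>] P(3)[of t] t \<rho>[OF G[OF I[OF t]]]
      unfolding I_def has_vector_derivative_def by blast
    moreover have "linear (\<rho>' (\<alpha> t))"
      using \<rho>[OF G[OF I[OF t]]] has_derivative_linear by blast
    ultimately have "((\<lambda>t. \<rho> (\<alpha> t)) has_real_derivative \<rho>' (\<alpha> t) (vector_derivative \<alpha> (at t))) (at t)"
      by (simp add: has_field_derivative_def linear_cmul mult_commute_abs)
    then show ?thesis
      unfolding g_def g'_def using pos[OF G[OF I[OF t]]] t
      by (auto simp flip: has_real_derivative_iff_has_vector_derivative
          intro!: derivative_eq_intros simp: field_simps)
  qed
  have gcont: "continuous_on {0..1} g"
    unfolding g_def using pos[OF G]
    by (intro continuous_intros continuous_on_compose2[OF \<rho>cont P(2)] \<alpha>(2)) force+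
  have "(g' has_integral g 1 - g 0) {0..1}"
    by (rule fundamental_theorem_of_calculus_interior_strong[OF P(1)])
      (use g gcont in \<open>auto simp: I_def\<close>)
  then have int: "(g' has_integral g 1 - g 0) UNIV"
    by (rule has_integral_on_superset) (auto simp: g'_def I_def)
  have "continuous_on I (\<lambda>t. (\<alpha> t, vector_derivative \<alpha> (at t)))"
    using P(4) by (intro continuous_intros continuous_on_subset[OF P(2)]) (auto simp: I_def)
  then have "continuous_on I (\<lambda>t. \<rho>' (\<alpha> t) (vector_derivative \<alpha> (at t)))"
    using continuous_on_compose2[OF cont, of I "\<lambda>t. (\<alpha> t, vector_derivative \<alpha> (at t))"] G I by force
  moreover have "continuous_on I (\<lambda>t. \<rho> (\<alpha> t))"
    using I G by (intro continuous_on_compose2[OF \<rho>cont] continuous_on_subset[OF P(2)]) auto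
  ultimately have "continuous_on I (\<lambda>t. \<rho>' (\<alpha> t) (vector_derivative \<alpha> (at t)) / (2 * \<rho> (\<alpha> t)))"
    using pos[OF G[OF I]] by (intro continuous_intros) force+
  moreover have "I \<in> sets borel"
    unfolding I_def using P(1) by (simp add: borel_closed finite_imp_closed sets.Diff)
  ultimately have "g' \<in> borel_measurable borel"
    unfolding g'_def by (intro borel_measurable_continuous_on_indicator)
  then have meas: "g' \<in> borel_measurable lborel" by simp
  have le: "(\<integral>\<^sup>+t. ennreal (norm (g' t)) \<partial>lborel) \<le> kobayashi_length G \<alpha>"
  proof -
    have "(\<integral>\<^sup>+t. ennreal (norm (g' t)) \<partial>lborel) = (\<integral>\<^sup>+t\<in>{0..1}. ennreal (norm (g' t)) \<partial>lborel)"
      by (intro nn_integral_cong) (auto simp: g'_def I_def split: split_indicator)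
    also have "\<dots> \<le> kobayashi_length G \<alpha>"
      unfolding kobayashi_length_def
    proof (rule nn_integral_mono_off_finite[OF P(1)], rule ennreal_leI)
      fix t assume "t \<in> {0<..<1} - P"
      then have t: "t \<in> I" by (simp add: I_def)
      have "norm (g' t) = \<bar>\<rho>' (\<alpha> t) (vector_derivative \<alpha> (at t))\<bar> / (2 * \<rho> (\<alpha> t))"
        using t pos[OF G[OF I[OF t]]] by (simp add: g'_def)
      also have "\<dots> \<le> kobayashi_metric G (\<alpha> t) (vector_derivative \<alpha> (at t))"
        using G[OF I[OF t]] by (intro kobayashi_metric_ge_pluriharmonic assms(1) \<rho> h pos) auto
      finally show "norm (g' t) \<le> kobayashi_metric G (\<alpha> t) (vector_derivative \<alpha> (at t))" .
    qed
    finally show ?thesis .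
  qed
  then have "integrable lborel g'"
    using meas kobayashi_length_finite[OF assms(1,2)] by (intro integrableI_bounded) (auto intro: le_less_trans)
  then have "ennreal (norm (integral\<^sup>L lborel g')) \<le> (\<integral>\<^sup>+t. ennreal (norm (g' t)) \<partial>lborel)"
    and "(g' has_integral integral\<^sup>L lborel g') UNIV"
    by (rule integral_norm_bound_ennreal, rule has_integral_integral_lborel)
  then have "ennreal \<bar>g 1 - g 0\<bar> \<le> kobayashi_length G \<alpha>"
    using le has_integral_unique[OF int] by (simp add: order_trans)
  moreover have "\<bar>g 1 - g 0\<bar> = \<bar>ln (\<rho> q) - ln (\<rho> p)\<bar> / 2"
    using \<alpha> by (simp add: g_def flip: diff_divide_distrib)
  ultimately show ?thesis by simp
qed

section \<open>The integrated distance\<close>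

lemma kobayashi_dist_le:
  assumes "\<alpha> \<in> curves_joining G p q" "kobayashi_length G \<alpha> \<le> ennreal c" "0 \<le> c"
  shows "kobayashi_dist G p q \<le> c"
proof -
  have "(INF \<alpha>\<in>curves_joining G p q. kobayashi_length G \<alpha>) \<le> ennreal c"
    using assms(1,2) by (rule INF_lower2[of \<alpha> _ "kobayashi_length G"])
  then show ?thesis
    unfolding kobayashi_dist_def using assms(3) enn2real_leI by blast
qed

lemma kobayashi_dist_nonneg: "0 \<le> kobayashi_dist G p q"
  by (simp add: kobayashi_dist_def)

text \<open>
  As soon as the points are joined by some curve, the infimum is finite and the passage to real numbers
  in \<open>kobayashi_dist\<close> is faithful; otherwise the value of \<open>kobayashi_dist\<close> would be \<open>0\<close> by default. This is why
  the lower bounds below ask for a joining curve.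
\<close>

lemma INF_kobayashi_length_eq:
  assumes "open G" "curves_joining G p q \<noteq> {}"
  shows "(INF \<alpha>\<in>curves_joining G p q. kobayashi_length G \<alpha>) = ennreal (kobayashi_dist G p q)"
proof -
  obtain \<alpha> where \<alpha>: "\<alpha> \<in> curves_joining G p q" using assms(2) by blast
  have "(INF \<alpha>\<in>curves_joining G p q. kobayashi_length G \<alpha>) < \<infinity>"
    using INF_lower[OF \<alpha>, of "kobayashi_length G"] kobayashi_length_finite[OF assms(1) \<alpha>] le_less_trans by blast
  then show ?thesis by (simp add: kobayashi_dist_def)
qed

lemma kobayashi_dist_ge:
  assumes "open G" "curves_joining G p q \<noteq> {}"
    and "\<And>\<alpha>. \<alpha> \<in> curves_joining G p q \<Longrightarrow> ennreal c \<le> kobayashi_length G \<alpha>"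
  shows "c \<le> kobayashi_dist G p q"
proof -
  have "ennreal c \<le> ennreal (kobayashi_dist G p q)"
    unfolding INF_kobayashi_length_eq[OF assms(1,2), symmetric] using assms(3) by (rule INF_greatest)
  then show ?thesis by (simp add: kobayashi_dist_nonneg)
qed

lemma kobayashi_dist_matrix_le:
  fixes A :: "complex^'m^'k"
  assumes "open G" "open H" "curves_joining G p q \<noteq> {}" and T: "\<And>x. x \<in> G \<Longrightarrow> A *v x + c \<in> H"
  shows "kobayashi_dist H (A *v p + c) (A *v q + c) \<le> kobayashi_dist G p q"
proof (rule kobayashi_dist_ge[OF assms(1,3)])
  fix \<alpha> assume \<alpha>: "\<alpha> \<in> curves_joining G p q"
  note * = kobayashi_length_matrix[OF assms(1) \<alpha> T]
  have "ennreal (kobayashi_dist H (A *v p + c) (A *v q + c)) \<le> kobayashi_length H (\<lambda>t. A *v \<alpha> t + c)"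
    using *(1) INF_kobayashi_length_eq[OF assms(2), symmetric] by (metis INF_lower empty_iff)
  then show "ennreal (kobayashi_dist H (A *v p + c) (A *v q + c)) \<le> kobayashi_length G \<alpha>"
    using *(2) by (rule order_trans)
qed

lemma kobayashi_dist_sym: "kobayashi_dist G p q = kobayashi_dist G q p"
proof -
  have *: "(INF \<alpha>\<in>curves_joining G p q. kobayashi_length G \<alpha>)
      \<le> (INF \<alpha>\<in>curves_joining G q p. kobayashi_length G \<alpha>)" for p q
    using kobayashi_length_reverse[of _ G q p] by (intro INF_mono) blast
  show ?thesis
    unfolding kobayashi_dist_def by (rule arg_cong[of _ _ enn2real], rule antisym) (rule *)+
qed

lemma kobayashi_length_stop_outside:
  assumes "open G" "\<alpha> \<in> curves_joining G p q" "0 \<le> a" "a \<le> b" "b \<le> 1"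
  shows "stop_outside a b \<alpha> \<in> curves_joining G (\<alpha> a) (\<alpha> b)"
    and "kobayashi_length G (stop_outside a b \<alpha>) \<le>
      (\<integral>\<^sup>+t\<in>{a<..b}. ennreal (kobayashi_metric G (\<alpha> t) (vector_derivative \<alpha> (at t))) \<partial>lborel)"
proof -
  have \<alpha>: "piecewise_C1_curve \<alpha>" "\<alpha> ` {0..1} \<subseteq> G"
    using assms(2) by (auto simp: curves_joining_def)
  have G: "\<alpha> t \<in> G" if "t \<in> {0..1}" for t using \<alpha>(2) that by auto
  have "stop_outside a b \<alpha> t \<in> G" for t
    unfolding stop_outside_def using assms(3-5) by (intro G) auto
  then show "stop_outside a b \<alpha> \<in> curves_joining G (\<alpha> a) (\<alpha> b)"
    using assms(3-5) piecewise_C1_curve_stop_outside[OF \<alpha>(1) assms(4)]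
    by (auto simp: curves_joining_def) (auto simp: stop_outside_def)
  obtain P where P: "finite P"
    "\<And>t. t \<in> {0<..<1} - P \<Longrightarrow> (\<alpha> has_vector_derivative vector_derivative \<alpha> (at t)) (at t)"
    using piecewise_C1_curve_obtain[OF \<alpha>(1)] by metis
  let ?\<kappa> = "\<lambda>t. ennreal (kobayashi_metric G (\<alpha> t) (vector_derivative \<alpha> (at t)))"
  have "kobayashi_length G (stop_outside a b \<alpha>) \<le> (\<integral>\<^sup>+t\<in>{0..1}. ?\<kappa> t * indicator {a<..b} t \<partial>lborel)"
    unfolding kobayashi_length_def
  proof (rule nn_integral_mono_off_finite[of "insert a (insert b P)"])
    fix t assume t: "t \<in> {0<..<1} - insert a (insert b P)"
    consider "t < a" | "b < t" | "a < t" "t < b" using t by fastforce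
    then show "ennreal (kobayashi_metric G (stop_outside a b \<alpha> t) (vector_derivative (stop_outside a b \<alpha>) (at t)))
        \<le> ?\<kappa> t * indicator {a<..b} t"
    proof cases
      case 1
      have "((\<lambda>t. \<alpha> a) has_vector_derivative 0) (at t)" by simp
      then have "(stop_outside a b \<alpha> has_vector_derivative 0) (at t)"
        by (rule has_vector_derivative_transform_within_open[of _ _ _ "{..<a}"])
          (use 1 assms(4) in \<open>auto simp: stop_outside_def\<close>)
      then show ?thesis
        using kobayashi_metric_zero[OF assms(1) \<open>\<And>t. stop_outside a b \<alpha> t \<in> G\<close>, of t]
        by (simp add: vector_derivative_at ennreal_neg)
    next
      case 2
      have "((\<lambda>t. \<alpha> b) has_vector_derivative 0) (at t)" by simp
      then have "(stop_outside a b \<alpha> has_vector_derivative 0) (at t)"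
        by (rule has_vector_derivative_transform_within_open[of _ _ _ "{b<..}"])
          (use 2 assms(4) in \<open>auto simp: stop_outside_def\<close>)
      then show ?thesis
        using kobayashi_metric_zero[OF assms(1) \<open>\<And>t. stop_outside a b \<alpha> t \<in> G\<close>, of t]
        by (simp add: vector_derivative_at ennreal_neg)
    next
      case 3
      have "(\<alpha> has_vector_derivative vector_derivative \<alpha> (at t)) (at t)" using P(2) t by auto
      then have "(stop_outside a b \<alpha> has_vector_derivative vector_derivative \<alpha> (at t)) (at t)"
        by (rule has_vector_derivative_transform_within_open[of _ _ _ "{a<..<b}"])
          (use 3 in \<open>auto simp: stop_outside_def\<close>)
      then show ?thesis
        using 3 by (simp add: vector_derivative_at stop_outside_def)
    qed
  qed (use P in auto)
  also have "\<dots> = (\<integral>\<^sup>+t\<in>{a<..b}. ?\<kappa> t \<partial>lborel)"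
    using assms(3-5) by (intro nn_integral_cong) (auto split: split_indicator)
  finally show "kobayashi_length G (stop_outside a b \<alpha>) \<le> (\<integral>\<^sup>+t\<in>{a<..b}. ?\<kappa> t \<partial>lborel)" .
qed

text \<open>
  An almost shortest curve is cut at the parameters where its arc length passes the multiples of
  \<open>l / n\<close>, with \<open>l\<close> its total length. These parameters exist by the intermediate value theorem, because
  arc length is a Lipschitz function of the parameter.
\<close>

lemma kobayashi_dist_subdivide:
  fixes G :: "(complex^'m) set"
  assumes "open G" "curves_joining G p q \<noteq> {}" and pos: "kobayashi_dist G p q > 0"
  obtains n x where "1 \<le> n" "real n \<le> kobayashi_dist G p q + 2" "x 0 = p" "x n = q"
    "\<And>i. i \<le> n \<Longrightarrow> x i \<in> G" "\<And>i. i < n \<Longrightarrow> kobayashi_dist G (x i) (x (Suc i)) \<le> 1"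
proof -
  define d where "d = kobayashi_dist G p q"
  have "(INF \<alpha>\<in>curves_joining G p q. kobayashi_length G \<alpha>) < ennreal (d + 1)"
    unfolding INF_kobayashi_length_eq[OF assms(1,2)] using pos by (simp add: d_def)
  then obtain \<alpha> where \<alpha>: "\<alpha> \<in> curves_joining G p q" "kobayashi_length G \<alpha> < ennreal (d + 1)"
    by (auto simp: INF_less_iff)
  let ?\<kappa> = "\<lambda>t. ennreal (kobayashi_metric G (\<alpha> t) (vector_derivative \<alpha> (at t)))"
  obtain P C where PC: "finite P" "0 \<le> C"
    "\<And>t. t \<in> {0<..<1} - P \<Longrightarrow> kobayashi_metric G (\<alpha> t) (vector_derivative \<alpha> (at t)) \<le> C"
    using kobayashi_metric_bounded_on_curve[OF assms(1) \<alpha>(1)] by metis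
  define F where "F t = (\<integral>\<^sup>+s\<in>{0..t}. ?\<kappa> s \<partial>lborel)" for t
  have F1: "F 1 = kobayashi_length G \<alpha>" by (simp add: F_def kobayashi_length_def)
  have F_add: "F t = F s + (\<integral>\<^sup>+u\<in>{s<..t}. ?\<kappa> u \<partial>lborel)" if "0 \<le> s" "s \<le> t" for s t
  proof -
    have "{0..t} = {0..s} \<union> {s<..t}" "{0..s} \<inter> {s<..t} = {}" using that by auto
    then show ?thesis
      unfolding F_def using nn_integral_disjoint_pair_nonmeasurable[of "{0..s}" lborel "{s<..t}" ?\<kappa>] by simp
  qed
  have F_fin: "F t < \<infinity>" if "0 \<le> t" "t \<le> 1" for t
  proof -
    have "F t \<le> F 1" using F_add[OF that] by simp
    then show ?thesis using F1 kobayashi_length_finite[OF assms(1) \<alpha>(1)] by (simp add: le_less_trans)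
  qed
  have lip: "(\<integral>\<^sup>+u\<in>{s<..t}. ?\<kappa> u \<partial>lborel) \<le> ennreal (C * (t - s))"
    if "0 \<le> s" "s \<le> t" "t \<le> 1" for s t
  proof -
    have "(\<integral>\<^sup>+u\<in>{s<..t}. ?\<kappa> u \<partial>lborel) = (\<integral>\<^sup>+u\<in>{0..1}. ?\<kappa> u * indicator {s<..t} u \<partial>lborel)"
      using that by (intro nn_integral_cong) (auto split: split_indicator)
    also have "\<dots> \<le> (\<integral>\<^sup>+u\<in>{0..1}. ennreal C * indicator {s<..t} u \<partial>lborel)"
      by (rule nn_integral_mono_off_finite[OF PC(1)]) (use PC(3) in \<open>auto intro!: mult_right_mono ennreal_leI\<close>)
    also have "\<dots> = (\<integral>\<^sup>+u. ennreal C * indicator {s<..t} u \<partial>lborel)"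
      using that by (intro nn_integral_cong) (auto split: split_indicator)
    also have "\<dots> = ennreal (C * (t - s))"
      using that PC(2) by (simp add: nn_integral_cmult_indicator ennreal_mult)
    finally show ?thesis .
  qed
  define f where "f t = enn2real (F t)" for t
  have F_f: "F t = ennreal (f t)" if "0 \<le> t" "t \<le> 1" for t
    using F_fin[OF that] by (simp add: f_def)
  have f_diff: "(\<integral>\<^sup>+u\<in>{s<..t}. ?\<kappa> u \<partial>lborel) = ennreal (f t - f s)" "f s \<le> f t" "f t - f s \<le> C * (t - s)"
    if "0 \<le> s" "s \<le> t" "t \<le> 1" for s t
  proof -
    let ?J = "\<integral>\<^sup>+u\<in>{s<..t}. ?\<kappa> u \<partial>lborel"
    have "?J \<le> ennreal (C * (t - s))" by (rule lip[OF that])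
    moreover have "0 \<le> C * (t - s)" using that PC(2) by simp
    ultimately obtain j where j: "?J = ennreal j" "0 \<le> j" "j \<le> C * (t - s)"
      by (cases ?J rule: ennreal_cases) (auto simp: top_unique)
    have "ennreal (f t) = ennreal (f s) + ennreal j"
      using F_add[OF that(1,2)] F_f[of t] F_f[of s] that j(1) by simp
    also have "\<dots> = ennreal (f s + j)" using j(2) by (simp add: f_def ennreal_plus)
    finally have "f t = f s + j"
      using j(2) by (subst (asm) ennreal_inj) (simp_all add: f_def)
    then show "?J = ennreal (f t - f s)" "f s \<le> f t" "f t - f s \<le> C * (t - s)"
      using j by auto
  qed
  have "continuous_on {0..1} f"
  proof (rule continuous_on_subset[OF lipschitz_on_continuous_on[of C "{0..1}"]])
    show "C-lipschitz_on {0..1} f"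
    proof (rule lipschitz_onI)
      fix s t :: real assume st: "s \<in> {0..1}" "t \<in> {0..1}"
      show "dist (f s) (f t) \<le> C * dist s t"
        using f_diff(2,3)[of s t] f_diff(2,3)[of t s] st by (cases "s \<le> t") (auto simp: dist_real_def)
    qed (rule PC(2))
  qed auto
  have f0: "f 0 = 0"
  proof -
    have "AE t in lborel. t \<noteq> (0::real)" by (rule AE_lborel_singleton)
    then have "F 0 = (\<integral>\<^sup>+t. 0 \<partial>(lborel :: real measure))"
      unfolding F_def by (intro nn_integral_cong_AE, elim eventually_mono) auto
    then show ?thesis by (simp add: f_def)
  qed
  define l where "l = f 1"
  have l: "0 < l" "l < d + 1"
  proof -
    have len: "kobayashi_length G \<alpha> = ennreal l" using F1 F_f[of 1] by (simp add: l_def)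
    have "0 \<le> l" by (simp add: l_def f_def)
    then show "l < d + 1" using \<alpha>(2) len by (simp add: ennreal_less_iff)
    have "d \<le> l" unfolding d_def
      using len \<open>0 \<le> l\<close> by (intro kobayashi_dist_le[OF \<alpha>(1)]) auto
    then show "0 < l" using pos by (simp add: d_def)
  qed
  \<comment> \<open>enough pieces that each has length at most one, yet at most \<open>d + 2\<close> of them\<close>
  define n where "n = nat \<lceil>d + 1\<rceil>"
  have n: "1 \<le> n" "real n \<le> d + 2" "l \<le> real n"
    using l unfolding n_def by linarith+
  \<comment> \<open>the endpoints are prescribed, since arc length need not be injective\<close>
  have "\<exists>t\<in>{0..1}. f t = l * i / n \<and> (i = 0 \<longrightarrow> t = 0) \<and> (i = n \<longrightarrow> t = 1)" if "i \<le> n" for i :: nat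
  proof -
    consider "i = 0" | "i = n" "i \<noteq> 0" | "0 < i" "i < n" using \<open>i \<le> n\<close> by linarith
    then show ?thesis
    proof cases
      case 1 then show ?thesis using f0 n(1) by (intro bexI[of _ 0]) auto
    next
      case 2 then show ?thesis using n(1) by (intro bexI[of _ 1]) (auto simp: l_def)
    next
      case 3
      have "l * i / n \<le> l * 1" using 3 l(1) by (simp add: divide_le_eq)
      then have "\<exists>t. 0 \<le> t \<and> t \<le> 1 \<and> f t = l * i / n"
        using l(1) f0 \<open>continuous_on {0..1} f\<close> by (intro IVT') (auto simp: l_def)
      then show ?thesis using 3 by auto
    qed
  qed
  then obtain \<tau> where \<tau>: "\<And>i. i \<le> n \<Longrightarrow> \<tau> i \<in> {0..1}" "\<And>i. i \<le> n \<Longrightarrow> f (\<tau> i) = l * real i / n"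
      "\<tau> 0 = 0" "\<tau> n = 1"
    by (metis le0 order_refl)
  show ?thesis
  proof (rule that[of n "\<lambda>i. \<alpha> (\<tau> i)"])
    show "1 \<le> n" "real n \<le> kobayashi_dist G p q + 2" using n by (auto simp: d_def)
    show "\<alpha> (\<tau> 0) = p" "\<alpha> (\<tau> n) = q" using \<tau>(3,4) \<alpha>(1) by (auto simp: curves_joining_def)
    show "\<alpha> (\<tau> i) \<in> G" if "i \<le> n" for i
      using \<tau>(1)[OF that] \<alpha>(1) by (auto simp: curves_joining_def)
    show "kobayashi_dist G (\<alpha> (\<tau> i)) (\<alpha> (\<tau> (Suc i))) \<le> 1" if "i < n" for i
    proof -
      have fi: "f (\<tau> (Suc i)) - f (\<tau> i) = l / n"
        using \<tau>(2)[of i] \<tau>(2)[of "Suc i"] that by (simp add: field_simps)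
      have "l / n > 0" using l n by simp
      then have "\<tau> i \<le> \<tau> (Suc i)"
        using fi f_diff(2)[of "\<tau> (Suc i)" "\<tau> i"] \<tau>(1)[of i] \<tau>(1)[of "Suc i"] that by force
      then have rng: "0 \<le> \<tau> i" "\<tau> i \<le> \<tau> (Suc i)" "\<tau> (Suc i) \<le> 1"
        using \<tau>(1)[of i] \<tau>(1)[of "Suc i"] that by auto
      note * = kobayashi_length_stop_outside[OF assms(1) \<alpha>(1) rng]
      have "kobayashi_length G (stop_outside (\<tau> i) (\<tau> (Suc i)) \<alpha>) \<le> ennreal (l / n)"
        using *(2) unfolding f_diff(1)[OF rng] fi .
      also have "\<dots> \<le> ennreal 1" using n by (intro ennreal_leI) (simp add: divide_le_eq)
      finally show ?thesis by (intro kobayashi_dist_le[OF *(1)]) auto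
    qed
  qed
qed

lemma curves_joining_nonempty:
  fixes G :: "(complex^'m) set"
  assumes "open G" "connected G" "p \<in> G" "q \<in> G"
  shows "curves_joining G p q \<noteq> {}"
proof -
  obtain g where g: "polynomial_function g" "path_image g \<subseteq> G" "pathstart g = p" "pathfinish g = q"
    using connected_open_polynomial_connected[OF assms] by blast
  obtain g' where g': "polynomial_function g'" "\<And>t. (g has_vector_derivative g' t) (at t)"
    using has_vector_derivative_polynomial_function[OF g(1)] by metis
  have "C1_between g 0 1"
    unfolding C1_between_def using g'
    by (intro exI[of _ g']) (auto intro: has_vector_derivative_at_within continuous_on_polymonial_function)
  then have "g \<in> curves_joining G p q"
    using g by (auto simp: curves_joining_def path_image_def pathstart_def pathfinish_def
        intro: C1_between_imp_piecewise)
  then show ?thesis by blast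
qed

lemma kobayashi_dist_ge_pluriharmonic:
  assumes "open G" "curves_joining G p q \<noteq> {}"
    and "\<And>x. x \<in> G \<Longrightarrow> (\<rho> has_derivative \<rho>' x) (at x)"
    and "continuous_on (G \<times> UNIV) (\<lambda>(x, X). \<rho>' x X)"
    and "\<And>f. analytic_disc G f \<Longrightarrow> \<exists>h. h holomorphic_on ball 0 1 \<and>
               (\<forall>\<zeta>\<in>ball 0 1. Re (h \<zeta>) = \<rho> (f \<zeta>))"
    and "\<And>x. x \<in> G \<Longrightarrow> \<rho> x > 0"
  shows "\<bar>ln (\<rho> q) - ln (\<rho> p)\<bar> / 2 \<le> kobayashi_dist G p q"
  by (rule kobayashi_dist_ge[OF assms(1,2)])
    (rule kobayashi_length_ge_pluriharmonic[OF assms(1) _ assms(3-6)], assumption+)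

text \<open>
  For a coordinate \<open>i\<close> let \<open>S\<close> be the supremum of \<open>Re (z $ i)\<close> over the domain. Then \<open>S - Re (z $ i)\<close> is
  positive and pluriharmonic on the open set \<open>\<Omega>\<close> and takes arbitrarily small values there.
\<close>

lemma kobayashi_dist_unbounded:
  fixes \<Omega> :: "(complex^'n) set"
  assumes "open \<Omega>" "connected \<Omega>" "bounded \<Omega>" "z\<^sub>0 \<in> \<Omega>"
  obtains p where "p \<in> \<Omega>" "M \<le> kobayashi_dist \<Omega> z\<^sub>0 p"
proof -
  fix i :: 'n
  define S where "S = (SUP z\<in>\<Omega>. Re (z $ i))"
  define \<rho> where "\<rho> z = S - Re (z $ i)" for z :: "complex^'n"
  obtain b where b: "\<And>z. z \<in> \<Omega> \<Longrightarrow> norm z \<le> b" using assms(3) by (auto simp: bounded_iff)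
  have "Re (z $ i) \<le> b" if "z \<in> \<Omega>" for z
    using b[OF that] complex_Re_le_cmod[of "z $ i"] Finite_Cartesian_Product.norm_nth_le[of z i] by linarith
  then have bdd: "bdd_above ((\<lambda>z. Re (z $ i)) ` \<Omega>)" by (auto simp: bdd_above_def)
  have pos: "\<rho> z > 0" if "z \<in> \<Omega>" for z
  proof -
    obtain e where e: "e > 0" "cball z e \<subseteq> \<Omega>"
      using open_contains_cball[THEN iffD1, OF assms(1)] \<open>z \<in> \<Omega>\<close> by blast
    have "norm (axis i (of_real e) :: complex^'n) = norm (of_real e :: complex)"
      unfolding norm_eq_sqrt_inner by (simp only: inner_axis_axis simp_thms if_True)
    then have "z + axis i (of_real e) \<in> \<Omega>"
      using e by (intro subsetD[OF e(2)]) (simp add: dist_norm)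
    then have "Re ((z + axis i (of_real e)) $ i) \<le> S" unfolding S_def by (rule cSUP_upper[OF _ bdd])
    then show ?thesis using e(1) by (simp add: \<rho>_def axis_def)
  qed
  define \<epsilon> where "\<epsilon> = \<rho> z\<^sub>0 * exp (- 2 * \<bar>M\<bar>)"
  have "\<epsilon> > 0" using pos[OF assms(4)] by (simp add: \<epsilon>_def)
  then have "S - \<epsilon> < (SUP z\<in>\<Omega>. Re (z $ i))" by (simp add: S_def)
  then have "\<exists>p\<in>\<Omega>. S - \<epsilon> < Re (p $ i)"
    using less_cSUP_iff[OF _ bdd] assms(4) by blast
  then obtain p where p: "p \<in> \<Omega>" "\<rho> p < \<epsilon>" by (auto simp: \<rho>_def)
  have "ln (\<rho> p) \<le> ln \<epsilon>" using p pos[OF p(1)] by simp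
  also have "ln \<epsilon> = ln (\<rho> z\<^sub>0) - 2 * \<bar>M\<bar>"
    unfolding \<epsilon>_def using pos[OF assms(4)] by (simp add: ln_mult)
  finally have "2 * M \<le> - (ln (\<rho> p) - ln (\<rho> z\<^sub>0))" by (simp add: abs_if split: if_splits)
  also have "\<dots> \<le> \<bar>ln (\<rho> p) - ln (\<rho> z\<^sub>0)\<bar>" by (rule abs_ge_minus_self)
  finally have "M \<le> \<bar>ln (\<rho> p) - ln (\<rho> z\<^sub>0)\<bar> / 2" by simp
  also have "\<dots> \<le> kobayashi_dist \<Omega> z\<^sub>0 p"
  proof (rule kobayashi_dist_ge_pluriharmonic[where \<rho>' = "\<lambda>x X. - Re (X $ i)"])
    show "(\<rho> has_derivative (\<lambda>X. - Re (X $ i))) (at x)" for x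
      unfolding \<rho>_def
      by (auto intro!: derivative_eq_intros bounded_linear_imp_has_derivative[OF bounded_linear_vec_nth])
    show "continuous_on (\<Omega> \<times> UNIV) (\<lambda>(x, X :: complex^'n). - Re (X $ i))"
      by (auto simp: case_prod_unfold intro!: continuous_intros)
    show "\<exists>h. h holomorphic_on ball 0 1 \<and> (\<forall>\<zeta>\<in>ball 0 1. Re (h \<zeta>) = \<rho> (f \<zeta>))"
      if "analytic_disc \<Omega> f" for f
      using that by (intro exI[of _ "\<lambda>\<zeta>. of_real S - f \<zeta> $ i"])
        (auto simp: \<rho>_def analytic_disc_def holomorphic_map_on_def intro!: holomorphic_intros)
  qed (use assms p pos curves_joining_nonempty in auto)
  finally show ?thesis using that p(1) by blast
qed

section \<open>Punctured Hartogs domains\<close>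

definition base_point :: "complex^('n option) \<Rightarrow> complex^'n" where
  "base_point x = (\<chi> i. x $ Some i)"

lemma append_coord_nth [simp]:
  "append_coord z w $ None = w" "append_coord z w $ Some i = z $ i"
  by (simp_all add: append_coord_def)

lemma base_point_append_coord [simp]: "base_point (append_coord z w) = z"
  by (simp add: base_point_def vec_eq_iff)

lemma append_coord_base_point: "append_coord (base_point x) (x $ None) = x"
  by (simp add: append_coord_def base_point_def vec_eq_iff split: option.split)

text \<open>
  The projection to the base and the slices \<open>w = const\<close> are complex affine maps, written with matrices so that
  they can be fed to \<open>kobayashi_dist_matrix_le\<close>.
\<close>

lemma base_point_matrix:
  "base_point x = (\<chi> i j. if j = Some i then 1 else 0) *v x + 0"
  by (simp add: base_point_def vec_eq_iff matrix_vector_mult_def if_distrib[of "\<lambda>a. a * _"] cong: if_cong)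

lemma append_coord_matrix:
  "append_coord z w = (\<chi> i j. if i = Some j then 1 else 0) *v z + append_coord 0 w"
proof -
  have "append_coord z w $ i = (\<Sum>j\<in>UNIV. (if i = Some j then 1 else 0) * z $ j) + append_coord 0 w $ i" for i
    by (cases i) (simp_all add: if_distrib[of "\<lambda>a. a * _"] cong: if_cong)
  then show ?thesis by (simp add: vec_eq_iff matrix_vector_mult_def)
qed

lemma mem_punctured_hartogs:
  "x \<in> punctured_hartogs \<Omega> \<phi> \<longleftrightarrow>
     base_point x \<in> \<Omega> \<and> x $ None \<noteq> 0 \<and> cmod (x $ None) < exp (- \<phi> (base_point x))"
  by (auto simp: punctured_hartogs_def) (metis append_coord_base_point)

lemma continuous_base_point: "continuous_on S base_point"
  unfolding base_point_def by (intro continuous_intros)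

locale hartogs_weight =
  fixes \<Omega> :: "(complex^'n) set" and \<phi> :: "complex^'n \<Rightarrow> real" and B :: real
  assumes open_base: "open \<Omega>" and connected_base: "connected \<Omega>"
    and weight_bound: "z \<in> \<Omega> \<Longrightarrow> \<bar>\<phi> z\<bar> \<le> B"
    and open_sub: "open {(z, w :: complex). z \<in> \<Omega> \<and> cmod w < exp (- \<phi> z)}"
begin

abbreviation G :: "(complex^('n option)) set" where
  "G \<equiv> punctured_hartogs \<Omega> \<phi>"

lemma open_hartogs: "open G"
proof -
  let ?S = "{(z, w :: complex). z \<in> \<Omega> \<and> cmod w < exp (- \<phi> z)} - UNIV \<times> {0}"
  have "open ?S" by (intro open_Diff open_sub closed_Times) auto
  moreover have "continuous_on UNIV (\<lambda>x :: complex^('n option). (base_point x, x $ None))"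
    by (intro continuous_intros continuous_base_point)
  ultimately have "open ((\<lambda>x. (base_point x, x $ None)) -` ?S)" by (rule open_vimage)
  moreover have "(\<lambda>x. (base_point x, x $ None)) -` ?S = G"
    by (auto simp: mem_punctured_hartogs)
  ultimately show ?thesis by simp
qed

lemma append_coord_in_hartogs:
  assumes "z \<in> \<Omega>" "w \<noteq> 0" "cmod w < exp (- B)"
  shows "append_coord z w \<in> G"
proof -
  have "exp (- B) \<le> exp (- \<phi> z)" using weight_bound[OF assms(1)] by simp
  with assms(3) have "cmod w < exp (- \<phi> z)" by (rule less_le_trans)
  then show ?thesis using assms by (simp add: mem_punctured_hartogs)
qed

text \<open>
  The subset \<open>{(z, w). z \<in> \<Omega>, 0 < \<bar>w\<bar> < exp (-B)}\<close> is open and connected as a product, and it contains all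
  points that the proof uses.
\<close>

lemma curves_joining_hartogs_nonempty:
  assumes "z \<in> \<Omega>" "w \<noteq> 0" "cmod w < exp (- B)" "z' \<in> \<Omega>" "w' \<noteq> 0" "cmod w' < exp (- B)"
  shows "curves_joining G (append_coord z w) (append_coord z' w') \<noteq> {}"
proof -
  let ?D = "ball 0 (exp (- B)) - {0 :: complex}"
  let ?f = "\<lambda>x :: complex^('n option). (base_point x, x $ None)"
  let ?g = "\<lambda>(z :: complex^'n, w). append_coord z w"
  have vimage: "?f -` (\<Omega> \<times> ?D) = ?g ` (\<Omega> \<times> ?D)"
  proof
    show "?f -` (\<Omega> \<times> ?D) \<subseteq> ?g ` (\<Omega> \<times> ?D)"
    proof
      fix x assume "x \<in> ?f -` (\<Omega> \<times> ?D)"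
      then show "x \<in> ?g ` (\<Omega> \<times> ?D)"
        by (intro image_eqI[of _ _ "?f x"]) (auto simp: append_coord_base_point)
    qed
  qed auto
  have "open (?f -` (\<Omega> \<times> ?D))"
    by (intro open_vimage open_Times open_base open_Diff continuous_intros continuous_base_point) auto
  moreover have "connected (?g ` (\<Omega> \<times> ?D))"
  proof (rule connected_continuous_image)
    have "continuous_on (\<Omega> \<times> ?D) (\<lambda>x. case i of Some j \<Rightarrow> fst x $ j | None \<Rightarrow> snd x)" for i :: "'n option"
      by (cases i) (auto intro!: continuous_intros)
    then show "continuous_on (\<Omega> \<times> ?D) ?g"
      unfolding append_coord_def case_prod_unfold by (intro continuous_intros)
    have "connected ?D" by (rule connected_punctured_ball) simp
    then show "connected (\<Omega> \<times> ?D)" by (intro connected_Times connected_base)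
  qed
  ultimately have "curves_joining (?g ` (\<Omega> \<times> ?D)) (append_coord z w) (append_coord z' w') \<noteq> {}"
    using assms by (intro curves_joining_nonempty) (auto simp: vimage)
  then obtain \<alpha> where "\<alpha> \<in> curves_joining (?g ` (\<Omega> \<times> ?D)) (append_coord z w) (append_coord z' w')"
    by blast
  moreover have "?g ` (\<Omega> \<times> ?D) \<subseteq> G" by (auto intro: append_coord_in_hartogs)
  ultimately have "\<alpha> \<in> curves_joining G (append_coord z w) (append_coord z' w')"
    unfolding curves_joining_def by blast
  then show ?thesis by blast
qed

lemma kobayashi_dist_base_le:
  assumes "z \<in> \<Omega>" "w \<noteq> 0" "cmod w < exp (- B)" "z' \<in> \<Omega>" "w' \<noteq> 0" "cmod w' < exp (- B)"
  shows "kobayashi_dist \<Omega> z z' \<le> kobayashi_dist G (append_coord z w) (append_coord z' w')"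
proof -
  have "kobayashi_dist \<Omega> (base_point (append_coord z w)) (base_point (append_coord z' w'))
      \<le> kobayashi_dist G (append_coord z w) (append_coord z' w')"
    unfolding base_point_matrix
    by (rule kobayashi_dist_matrix_le[OF open_hartogs open_base curves_joining_hartogs_nonempty[OF assms]])
      (subst base_point_matrix[symmetric], simp add: mem_punctured_hartogs)
  then show ?thesis by simp
qed

lemma kobayashi_dist_slice_le:
  assumes "z \<in> \<Omega>" "z' \<in> \<Omega>" "w \<noteq> 0" "cmod w < exp (- B)"
  shows "kobayashi_dist G (append_coord z w) (append_coord z' w) \<le> kobayashi_dist \<Omega> z z'"
  unfolding append_coord_matrix[of z] append_coord_matrix[of z']
  by (rule kobayashi_dist_matrix_le[OF open_base open_hartogs curves_joining_nonempty])
    (use assms open_base connected_base append_coord_in_hartogs in \<open>auto simp flip: append_coord_matrix\<close>)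

text \<open>
  Here \<open>\<tau>\<close> is the arc length parameter of the punctured disc of radius \<open>exp (-B)\<close> along its positive radius,
  for the metric \<open>\<bar>dw\<bar> / (2 \<bar>w\<bar> ln (exp (-B) / \<bar>w\<bar>))\<close>; the puncture is at \<open>\<tau> = \<infinity>\<close>.
\<close>

definition cusp_height :: "real \<Rightarrow> complex" where
  "cusp_height \<tau> = of_real (exp (- B) * exp (- exp (2 * \<tau>)))"

lemma cusp_height: "cusp_height \<tau> \<noteq> 0" "cmod (cusp_height \<tau>) < exp (- B)"
  by (simp_all add: cusp_height_def norm_mult)

lemma weight_bound_nonneg: "z \<in> \<Omega> \<Longrightarrow> 0 \<le> B"
  using weight_bound by force

text \<open>
  Apply the half-plane bound to \<open>\<rho>(z, w) = B - ln \<bar>w\<bar>\<close>, which is positive because \<open>\<bar>w\<bar> < exp B\<close>. At height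
  \<open>\<tau>\<close> it equals \<open>2 B + exp (2 \<tau>)\<close>; the summand \<open>2 B\<close> is the price for the gap between the inner radius
  \<open>exp (-B)\<close> and the outer radius \<open>exp B\<close>, and it costs only a bounded error after taking logarithms.
\<close>

lemma kobayashi_dist_cusp_ge:
  assumes "z \<in> \<Omega>" "z' \<in> \<Omega>" "0 \<le> \<tau>" "0 \<le> \<tau>'"
  shows "\<bar>\<tau>' - \<tau>\<bar> - ln (1 + 2 * B) / 2
    \<le> kobayashi_dist G (append_coord z (cusp_height \<tau>)) (append_coord z' (cusp_height \<tau>'))"
proof -
  define \<rho> where "\<rho> x = B - ln (cmod (x $ None))" for x :: "complex^('n option)"
  define \<rho>' where "\<rho>' x X = - Re (X $ None / x $ None)" for x X :: "complex^('n option)"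
  have B: "0 \<le> B" using weight_bound_nonneg assms(1) by blast
  have \<rho>_height: "\<rho> (append_coord z (cusp_height \<tau>)) = 2 * B + exp (2 * \<tau>)" for z \<tau>
    by (simp add: \<rho>_def cusp_height_def norm_mult ln_mult)
  have bound: "\<bar>\<tau>' - \<tau>\<bar> - ln (1 + 2 * B) / 2 \<le>
     \<bar>ln (2 * B + exp (2 * \<tau>')) - ln (2 * B + exp (2 * \<tau>))\<bar> / 2"
  proof -
    have low: "2 * t \<le> ln (2 * B + exp (2 * t))" for t
    proof -
      have "ln (exp (2 * t)) \<le> ln (2 * B + exp (2 * t))"
        using B by (intro ln_mono) (auto simp: add_nonneg_pos)
      then show ?thesis by simp
    qed
    have up: "ln (2 * B + exp (2 * t)) \<le> ln (1 + 2 * B) + 2 * t" if "0 \<le> t" for t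
    proof -
      have "2 * B * 1 \<le> 2 * B * exp (2 * t)" using that B by (intro mult_left_mono) auto
      then have "ln (2 * B + exp (2 * t)) \<le> ln ((1 + 2 * B) * exp (2 * t))"
        using B by (intro ln_mono) (auto simp: add_nonneg_pos algebra_simps)
      then show ?thesis using B by (simp add: ln_mult)
    qed
    show ?thesis
      using low[of \<tau>] low[of \<tau>'] up[OF assms(3)] up[OF assms(4)] by (cases "\<tau> \<le> \<tau>'") (auto simp: abs_if field_simps)
  qed
  have "\<bar>ln (\<rho> (append_coord z' (cusp_height \<tau>'))) - ln (\<rho> (append_coord z (cusp_height \<tau>)))\<bar> / 2
    \<le> kobayashi_dist G (append_coord z (cusp_height \<tau>)) (append_coord z' (cusp_height \<tau>'))"
  proof (rule kobayashi_dist_ge_pluriharmonic[where \<rho>' = \<rho>'])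
    fix x :: "complex^('n option)" assume x: "x \<in> G"
    then have nz: "x $ None \<noteq> 0" by (simp add: mem_punctured_hartogs)
    have "cmod (x $ None) < exp B"
      using x weight_bound[of "base_point x"]
      by (auto simp: mem_punctured_hartogs elim!: less_le_trans)
    then have "ln (cmod (x $ None)) < ln (exp B)" using nz by (subst ln_less_cancel_iff) auto
    then show "\<rho> x > 0" by (simp add: \<rho>_def)
    have sq: "(Re (x $ None))\<^sup>2 + (Im (x $ None))\<^sup>2 > 0"
      using nz by (metis complex_neq_0)
    have "((\<lambda>x. (Re (x $ None))\<^sup>2 + (Im (x $ None))\<^sup>2) has_derivative
        (\<lambda>X. 2 * Re (x $ None) * Re (X $ None) + 2 * Im (x $ None) * Im (X $ None))) (at x)"
      by (auto intro!: derivative_eq_intros bounded_linear_imp_has_derivative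
          bounded_linear_compose[OF bounded_linear_Re] bounded_linear_compose[OF bounded_linear_Im]
          bounded_linear_vec_nth)
    note ln_deriv = has_derivative_ln[OF sq this]
    have "((\<lambda>x. B - ln ((Re (x $ None))\<^sup>2 + (Im (x $ None))\<^sup>2) / 2) has_derivative
        (\<lambda>X. 0 - ((2 * Re (x $ None) * Re (X $ None) + 2 * Im (x $ None) * Im (X $ None))
           * inverse ((Re (x $ None))\<^sup>2 + (Im (x $ None))\<^sup>2) / 2))) (at x)"
      by (intro has_derivative_diff has_derivative_const
          bounded_linear.has_derivative[OF bounded_linear_divide] ln_deriv)
    moreover have "(\<lambda>X. 0 - ((2 * Re (x $ None) * Re (X $ None) + 2 * Im (x $ None) * Im (X $ None))
           * inverse ((Re (x $ None))\<^sup>2 + (Im (x $ None))\<^sup>2) / 2)) = \<rho>' x"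
    proof
      fix X :: "complex^('n option)"
      have half: "0 - 2 * q * inverse s / 2 = - (q / s)" for q s :: real
        by (simp add: inverse_eq_divide)
      have eq: "2 * Re (x $ None) * Re (X $ None) + 2 * Im (x $ None) * Im (X $ None)
          = 2 * (Re (X $ None) * Re (x $ None) + Im (X $ None) * Im (x $ None))"
        by simp
      show "0 - (2 * Re (x $ None) * Re (X $ None) + 2 * Im (x $ None) * Im (X $ None))
           * inverse ((Re (x $ None))\<^sup>2 + (Im (x $ None))\<^sup>2) / 2 = \<rho>' x X"
        unfolding \<rho>'_def Re_divide eq by (rule half)
    qed
    ultimately have "((\<lambda>x. B - ln ((Re (x $ None))\<^sup>2 + (Im (x $ None))\<^sup>2) / 2) has_derivative \<rho>' x) (at x)"
      by simp
    moreover have "\<rho> = (\<lambda>x. B - ln ((Re (x $ None))\<^sup>2 + (Im (x $ None))\<^sup>2) / 2)"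
    proof
      show "\<rho> x = B - ln ((Re (x $ None))\<^sup>2 + (Im (x $ None))\<^sup>2) / 2" for x
        by (cases "x $ None = 0") (auto simp: \<rho>_def cmod_def ln_sqrt complex_neq_0)
    qed
    ultimately show "(\<rho> has_derivative \<rho>' x) (at x)" by simp
  next
    show "continuous_on (G \<times> UNIV) (\<lambda>(x, X). \<rho>' x X)"
      unfolding \<rho>'_def case_prod_unfold by (intro continuous_intros) (auto simp: mem_punctured_hartogs)
  next
    fix f assume f: "analytic_disc G f"
    have "(\<lambda>\<zeta>. f \<zeta> $ None) holomorphic_on ball 0 1"
      using f by (simp add: analytic_disc_def holomorphic_map_on_def)
    moreover have "f \<zeta> $ None \<noteq> 0" if "\<zeta> \<in> ball 0 1" for \<zeta>
      using f that by (auto simp: analytic_disc_def mem_punctured_hartogs image_subset_iff)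
    ultimately obtain g where g: "g holomorphic_on ball 0 1" "\<And>\<zeta>. \<zeta> \<in> ball 0 1 \<Longrightarrow> exp (g \<zeta>) = f \<zeta> $ None"
      using holomorphic_logarithm_exists[of "ball 0 1" "\<lambda>\<zeta>. f \<zeta> $ None" 0] by auto
    have "Re (of_real B - g \<zeta>) = \<rho> (f \<zeta>)" if "\<zeta> \<in> ball 0 1" for \<zeta>
      unfolding \<rho>_def g(2)[OF that, symmetric] by simp
    then show "\<exists>h. h holomorphic_on ball 0 1 \<and> (\<forall>\<zeta>\<in>ball 0 1. Re (h \<zeta>) = \<rho> (f \<zeta>))"
      using g(1) by (intro exI[of _ "\<lambda>\<zeta>. of_real B - g \<zeta>"]) (auto intro!: holomorphic_intros)
  qed (use assms open_hartogs cusp_height curves_joining_hartogs_nonempty in auto)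
  then show ?thesis using bound by (simp add: \<rho>_height)
qed

text \<open>
  The witness is the universal covering of the punctured disc of radius \<open>exp (-B)\<close>, based at the point
  with \<open>ln (exp (-B) / \<bar>w\<bar>) = \<sigma>\<close>.
\<close>

lemma kobayashi_metric_cusp_le:
  assumes "z \<in> \<Omega>" "0 < \<sigma>"
  shows "kobayashi_metric G (append_coord z (of_real (exp (- B) * exp (- \<sigma>))))
     (append_coord 0 (of_real (- (s * (exp (- B) * exp (- \<sigma>)))))) \<le> \<bar>s\<bar> / (2 * \<sigma>)"
proof -
  define g :: "complex \<Rightarrow> complex" where
    "g \<zeta> = of_real (exp (- B)) * exp (- (of_real \<sigma> * ((1 + \<zeta>) / (1 - \<zeta>))))" for \<zeta>
  have hol: "g holomorphic_on ball 0 1"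
    unfolding g_def by (intro holomorphic_intros) auto
  have lt: "cmod (g \<zeta>) < exp (- B)" if "\<zeta> \<in> ball 0 1" for \<zeta>
  proof -
    have "cmod \<zeta> < 1" using that by simp
    then have "(cmod \<zeta>)\<^sup>2 < 1" by (simp add: power_less_one_iff)
    moreover have "(Re \<zeta> - 1)\<^sup>2 + (Im \<zeta>)\<^sup>2 > 0"
      using \<open>cmod \<zeta> < 1\<close> complex_neq_0[of "\<zeta> - 1"] by fastforce
    moreover have "Re ((1 + \<zeta>) / (1 - \<zeta>)) = (1 - (cmod \<zeta>)\<^sup>2) / ((Re \<zeta> - 1)\<^sup>2 + (Im \<zeta>)\<^sup>2)"
      unfolding cmod_power2 by (simp add: Re_divide power2_eq_square algebra_simps)
    ultimately have "Re ((1 + \<zeta>) / (1 - \<zeta>)) > 0"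
      by simp
    moreover have "Re (of_real \<sigma> * q) > 0" if "Re q > 0" for q
      using assms(2) that by simp
    ultimately have "Re (of_real \<sigma> * ((1 + \<zeta>) / (1 - \<zeta>))) > 0" by blast
    then show ?thesis by (simp add: g_def norm_mult del: times_divide_eq_right)
  qed
  have "analytic_disc G (\<lambda>\<zeta>. append_coord z (g \<zeta>))"
  proof -
    have "(\<lambda>\<zeta>. append_coord z (g \<zeta>) $ i) holomorphic_on ball 0 1" for i
      using hol by (cases i) auto
    then show ?thesis
      using assms(1) lt by (auto simp: analytic_disc_def holomorphic_map_on_def g_def
          intro!: append_coord_in_hartogs)
  qed
  moreover have g0: "g 0 = of_real (exp (- B) * exp (- \<sigma>))"
    by (simp add: g_def exp_of_real flip: of_real_minus)
  moreover have "vderiv (\<lambda>\<zeta>. append_coord z (g \<zeta>)) 0 = append_coord 0 (- (2 * of_real \<sigma> * g 0))"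
  proof -
    have "(g has_field_derivative - (2 * of_real \<sigma> * g 0)) (at 0)"
      unfolding g_def by (auto intro!: derivative_eq_intros simp: field_simps)
    then have "deriv (\<lambda>\<zeta>. append_coord z (g \<zeta>) $ i) 0 = append_coord 0 (- (2 * of_real \<sigma> * g 0)) $ i" for i
      by (cases i) (auto simp: DERIV_imp_deriv)
    then show ?thesis by (simp add: vderiv_def vec_eq_iff)
  qed
  moreover have "(of_real (s / (2 * \<sigma>)) *s append_coord (0 :: complex^'n) (- (2 * of_real \<sigma> * g 0))) $ i
      = append_coord 0 (of_real (- (s * (exp (- B) * exp (- \<sigma>))))) $ i" for i
    using assms(2) g0 by (cases i) (auto simp: field_simps)
  ultimately have "kobayashi_metric G (append_coord z (of_real (exp (- B) * exp (- \<sigma>))))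
     (append_coord 0 (of_real (- (s * (exp (- B) * exp (- \<sigma>)))))) \<le> cmod (of_real (s / (2 * \<sigma>)))"
    by (intro kobayashi_metric_le[of G "\<lambda>\<zeta>. append_coord z (g \<zeta>)"]) (simp_all add: vec_eq_iff)
  then show ?thesis using assms(2) by (simp add: norm_divide)
qed

lemma kobayashi_dist_cusp_le:
  assumes "z \<in> \<Omega>"
  shows "kobayashi_dist G (append_coord z (cusp_height \<tau>)) (append_coord z (cusp_height \<tau>')) \<le> \<bar>\<tau>' - \<tau>\<bar>"
proof -
  define c where "c = \<tau>' - \<tau>"
  define u where "u t = cusp_height (\<tau> + t * c)" for t
  define \<alpha> where "\<alpha> t = append_coord z (u t)" for t
  define \<sigma> where "\<sigma> t = exp (2 * (\<tau> + t * c))" for t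
  have u: "u t = of_real (exp (- B) * exp (- \<sigma> t))" for t by (simp add: u_def cusp_height_def \<sigma>_def)
  then have ueq: "u = (\<lambda>t. of_real (exp (- B) * exp (- \<sigma> t)))" by blast
  define D where "D t = append_coord (0 :: complex^'n) (of_real (- (2 * c * \<sigma> t * (exp (- B) * exp (- \<sigma> t)))))" for t
  have "((\<lambda>t. exp (- B) * exp (- \<sigma> t)) has_real_derivative - (2 * c * \<sigma> t * (exp (- B) * exp (- \<sigma> t)))) (at t)" for t
    unfolding \<sigma>_def by (auto intro!: derivative_eq_intros)
  then have du: "(u has_vector_derivative of_real (- (2 * c * \<sigma> t * (exp (- B) * exp (- \<sigma> t))))) (at t)" for t
    unfolding ueq by (rule has_vector_derivative_of_real)
  have \<alpha>: "\<alpha> = (\<lambda>t. u t *s axis None 1 + append_coord z 0)"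
    by (simp add: fun_eq_iff \<alpha>_def vec_eq_iff axis_def append_coord_def split: option.split)
  have D: "D = (\<lambda>t. (of_real (- (2 * c * \<sigma> t * (exp (- B) * exp (- \<sigma> t)))) :: complex) *s axis None 1)"
    by (simp add: fun_eq_iff D_def vec_eq_iff axis_def append_coord_def split: option.split)
  have bl: "bounded_linear (\<lambda>w :: complex. w *s (axis None 1 :: complex^('n option)))"
    by (intro linear_conv_bounded_linear[THEN iffD1] linearI) (auto simp: vec_eq_iff algebra_simps)
  have d\<alpha>: "(\<alpha> has_vector_derivative D t) (at t)" for t
    unfolding \<alpha> D using bounded_linear.has_vector_derivative[OF bl du[of t]]
    by (simp add: has_vector_derivative_add_const)
  have "continuous_on {0..1} D"
    unfolding D \<sigma>_def by (intro bounded_linear.continuous_on[OF bl] continuous_intros)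
  then have "C1_between \<alpha> 0 1"
    unfolding C1_between_def using d\<alpha> by (auto intro: has_vector_derivative_at_within)
  then have "\<alpha> \<in> curves_joining G (append_coord z (cusp_height \<tau>)) (append_coord z (cusp_height \<tau>'))"
    using assms cusp_height by (auto simp: curves_joining_def \<alpha>_def u_def c_def
        intro: C1_between_imp_piecewise append_coord_in_hartogs)
  moreover have "kobayashi_length G \<alpha> \<le> ennreal \<bar>\<tau>' - \<tau>\<bar>"
    unfolding kobayashi_length_def
  proof (rule nn_integral_le_const_off_finite[of "{}"])
    fix t :: real
    have "\<sigma> t > 0" by (simp add: \<sigma>_def)
    then have "kobayashi_metric G (\<alpha> t) (D t) \<le> \<bar>c\<bar>"
      using kobayashi_metric_cusp_le[OF assms \<open>\<sigma> t > 0\<close>, of "2 * c * \<sigma> t"]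
      by (simp add: \<alpha>_def D_def u abs_mult)
    then show "ennreal (kobayashi_metric G (\<alpha> t) (vector_derivative \<alpha> (at t))) \<le> ennreal \<bar>\<tau>' - \<tau>\<bar>"
      using vector_derivative_at[OF d\<alpha>[of t]] by (simp add: c_def ennreal_leI)
  qed simp
  ultimately show ?thesis by (intro kobayashi_dist_le) auto
qed

end

section \<open>Failure of hyperbolicity\<close>

text \<open>
  The rectangle argument at scale \<open>L\<close>. The left-hand side grows linearly in \<open>L\<close>, while the admissible \<open>k\<close> grows only
  like \<open>log\<^sub>2 L\<close>.
\<close>

lemma (in hartogs_weight) hyperbolicity_bound:
  assumes hyp: "\<And>x y z b. \<lbrakk>x \<in> G; y \<in> G; z \<in> G; b \<in> G\<rbrakk> \<Longrightarrow>
      gromov_product (kobayashi_dist G) b x y \<ge>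
        min (gromov_product (kobayashi_dist G) b x z) (gromov_product (kobayashi_dist G) b z y) - \<delta>"
    and "0 \<le> \<delta>" and z0: "z\<^sub>0 \<in> \<Omega>" and p: "p \<in> \<Omega>" and L: "L = kobayashi_dist \<Omega> z\<^sub>0 p" "1 \<le> L"
    and k: "2 * L + 2 \<le> 2 ^ k"
  shows "L - 1 / 2 - 3 / 4 * ln (1 + 2 * B) \<le> (real k + 2) * \<delta>"
proof -
  let ?d = "kobayashi_dist G"
  define c where "c = ln (1 + 2 * B) / 2"
  define pt where "pt z \<tau> = append_coord z (cusp_height \<tau>)" for z :: "complex^'n" and \<tau>
  \<comment> \<open>the midpoint of the side of the rectangle that the path avoids\<close>
  define b where "b = pt z\<^sub>0 L"
  let ?gp = "gromov_product ?d b"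
  \<comment> \<open>two distances of at least \<open>L - c\<close> to the base point, minus a step of at most one, halved\<close>
  define A where "A = L - c - 1 / 2"
  have c: "0 \<le> c" using weight_bound_nonneg[OF z0] by (simp add: c_def)
  have pt: "pt z \<tau> \<in> G" if "z \<in> \<Omega>" for z \<tau>
    unfolding pt_def using that cusp_height by (intro append_coord_in_hartogs)
  have b: "b \<in> G" unfolding b_def by (rule pt[OF z0])
  have vert: "\<bar>\<tau>' - \<tau>\<bar> - c \<le> ?d (pt z \<tau>) (pt z' \<tau>')"
    if "z \<in> \<Omega>" "z' \<in> \<Omega>" "0 \<le> \<tau>" "0 \<le> \<tau>'" for z z' \<tau> \<tau>'
    unfolding pt_def c_def using that by (rule kobayashi_dist_cusp_ge)
  have vert_le: "?d (pt z \<tau>) (pt z \<tau>') \<le> \<bar>\<tau>' - \<tau>\<bar>" if "z \<in> \<Omega>" for z \<tau> \<tau>'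
    unfolding pt_def using that by (rule kobayashi_dist_cusp_le)
  have hor: "kobayashi_dist \<Omega> z z' \<le> ?d (pt z \<tau>) (pt z' \<tau>')" if "z \<in> \<Omega>" "z' \<in> \<Omega>" for z z' \<tau> \<tau>'
    unfolding pt_def using that cusp_height by (intro kobayashi_dist_base_le)
  have hor_le: "?d (pt z \<tau>) (pt z' \<tau>) \<le> kobayashi_dist \<Omega> z z'" if "z \<in> \<Omega>" "z' \<in> \<Omega>" for z z' \<tau>
    unfolding pt_def using that cusp_height by (intro kobayashi_dist_slice_le)
  have step: "A \<le> ?gp x y" if "L - c \<le> ?d x b" "L - c \<le> ?d y b" "?d x y \<le> 1" for x y
    using that by (simp add: gromov_product_def A_def)
  have chain: "A - real k * \<delta> \<le> ?gp (x 0) (x n)"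
    if "1 \<le> n" "real n \<le> 2 * L + 2" "\<And>i. i \<le> n \<Longrightarrow> x i \<in> G" "\<And>i. i \<le> n \<Longrightarrow> L - c \<le> ?d (x i) b"
      "\<And>i. i < n \<Longrightarrow> ?d (x i) (x (Suc i)) \<le> 1" for n and x :: "nat \<Rightarrow> complex^('n option)"
  proof (rule gromov_product_chain[where X = G])
    have "real n \<le> 2 ^ k" using that(2) k by (rule order_trans)
    then show "n \<le> 2 ^ k" by simp
    show "A \<le> ?gp (x i) (x (Suc i))" if "i < n" for i
      using \<open>i < n\<close> by (intro step \<open>\<And>i. i \<le> n \<Longrightarrow> L - c \<le> ?d (x i) b\<close> \<open>\<And>i. i < n \<Longrightarrow> ?d (x i) (x (Suc i)) \<le> 1\<close>) auto
  qed (use that hyp b \<open>0 \<le> \<delta>\<close> in auto)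
  \<comment> \<open>the horizontal sides keep their distance because \<open>b\<close> has height \<open>L\<close>, halfway between \<open>0\<close> and \<open>2 L\<close>\<close>
  have horizontal: "A - real k * \<delta> \<le> ?gp (pt u \<tau>) (pt v \<tau>)"
    if uv: "u \<in> \<Omega>" "v \<in> \<Omega>" "kobayashi_dist \<Omega> u v = L" and \<tau>: "\<tau> = 0 \<or> \<tau> = 2 * L" for u v \<tau>
  proof -
    obtain n x where x: "1 \<le> n" "real n \<le> kobayashi_dist \<Omega> u v + 2" "x 0 = u" "x n = v"
      "\<And>i. i \<le> n \<Longrightarrow> x i \<in> \<Omega>" "\<And>i. i < n \<Longrightarrow> kobayashi_dist \<Omega> (x i) (x (Suc i)) \<le> 1"
      using kobayashi_dist_subdivide[OF open_base curves_joining_nonempty[OF open_base connected_base uv(1,2)]]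
        uv(3) L(2) by (metis less_le_trans zero_less_one)
    have "A - real k * \<delta> \<le> ?gp (pt (x 0) \<tau>) (pt (x n) \<tau>)"
    proof (rule chain[of n "\<lambda>i. pt (x i) \<tau>"])
      show "L - c \<le> ?d (pt (x i) \<tau>) b" if "i \<le> n" for i
        using vert[OF x(5)[OF that] z0, of \<tau> L] \<tau> L(2) by (auto simp: b_def)
      show "?d (pt (x i) \<tau>) (pt (x (Suc i)) \<tau>) \<le> 1" if "i < n" for i
        using hor_le[of "x i" "x (Suc i)" \<tau>] x(5,6) that by force
    qed (use x pt uv L in auto)
    then show ?thesis using x by simp
  qed
  \<comment> \<open>the vertical side keeps its distance because it projects to \<open>p\<close>\<close>
  have vertical: "A - real k * \<delta> \<le> ?gp (pt p 0) (pt p (2 * L))"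
  proof -
    define n where "n = nat \<lceil>2 * L\<rceil>"
    have n: "1 \<le> n" "real n \<le> 2 * L + 1" "2 * L \<le> real n" using L(2) unfolding n_def by linarith+
    have "A - real k * \<delta> \<le> ?gp (pt p (2 * L * real 0 / real n)) (pt p (2 * L * real n / real n))"
    proof (rule chain[of n "\<lambda>i. pt p (2 * L * real i / real n)"])
      fix i
      have "L \<le> ?d (pt p (2 * L * real i / real n)) b"
        using hor[OF p z0, of "2 * L * real i / real n" L] L(1) kobayashi_dist_sym[of \<Omega> p z\<^sub>0] by (simp add: b_def)
      then show "L - c \<le> ?d (pt p (2 * L * real i / real n)) b" using c by simp
      have "2 * L * real (Suc i) / real n - 2 * L * real i / real n = 2 * L / real n"
        unfolding diff_divide_distrib[symmetric] by (simp add: algebra_simps)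
      also have "\<bar>\<dots>\<bar> \<le> 1" using n L(2) by (simp add: divide_le_eq)
      finally show "?d (pt p (2 * L * real i / real n)) (pt p (2 * L * real (Suc i) / real n)) \<le> 1"
        using vert_le[OF p, of "2 * L * real i / real n" "2 * L * real (Suc i) / real n"] by linarith
    qed (use n pt[OF p] in auto)
    then show ?thesis using n by simp
  qed
  have "kobayashi_dist \<Omega> p z\<^sub>0 = L" using L(1) kobayashi_dist_sym[of \<Omega> p] by simp
  then have legs: "A - real k * \<delta> \<le> ?gp (pt z\<^sub>0 0) (pt p 0)"
      "A - real k * \<delta> \<le> ?gp (pt p (2 * L)) (pt z\<^sub>0 (2 * L))"
    using horizontal[OF z0 p, of 0] horizontal[OF p z0, of "2 * L"] L(1) by simp_all
  \<comment> \<open>two more hyperbolicity inequalities glue the three sides\<close>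
  have "A - real k * \<delta> - \<delta> \<le> ?gp (pt z\<^sub>0 0) (pt p (2 * L))"
    using hyp[OF pt[OF z0, of 0] pt[OF p, of "2 * L"] pt[OF p, of 0] b] legs(1) vertical by linarith
  then have "A - real k * \<delta> - 2 * \<delta> \<le> ?gp (pt z\<^sub>0 0) (pt z\<^sub>0 (2 * L))"
    using hyp[OF pt[OF z0, of 0] pt[OF z0, of "2 * L"] pt[OF p, of "2 * L"] b] legs(2) \<open>0 \<le> \<delta>\<close> by linarith
  also have "\<dots> \<le> c / 2"
  proof -
    have "?d (pt z\<^sub>0 0) b \<le> L" "?d (pt z\<^sub>0 (2 * L)) b \<le> L"
      using vert_le[OF z0, of 0 L] vert_le[OF z0, of "2 * L" L] L(2) by (auto simp: b_def)
    moreover have "2 * L - c \<le> ?d (pt z\<^sub>0 0) (pt z\<^sub>0 (2 * L))"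
      using vert[OF z0 z0, of 0 "2 * L"] L(2) by simp
    ultimately show ?thesis by (simp add: gromov_product_def)
  qed
  finally show ?thesis by (simp add: A_def c_def algebra_simps)
qed

theorem theorem1p8:
  fixes \<Omega> :: "(complex^'n) set" and \<phi> :: "complex^'n \<Rightarrow> real"
  assumes "bounded \<Omega>"
    and "C_convex \<Omega>"
    and "bounded (\<phi> ` \<Omega>)"
    and "open {(z, w :: complex). z \<in> \<Omega> \<and> cmod w < exp (- \<phi> z)}"
  shows "\<not> gromov_hyperbolic (punctured_hartogs \<Omega> \<phi>)
             (kobayashi_dist (punctured_hartogs \<Omega> \<phi>))"
proof
  assume "gromov_hyperbolic (punctured_hartogs \<Omega> \<phi>) (kobayashi_dist (punctured_hartogs \<Omega> \<phi>))"
  then obtain \<delta> where \<delta>: "0 \<le> \<delta>" and hyp: "\<And>x y z b. \<lbrakk>x \<in> punctured_hartogs \<Omega> \<phi>;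
      y \<in> punctured_hartogs \<Omega> \<phi>; z \<in> punctured_hartogs \<Omega> \<phi>; b \<in> punctured_hartogs \<Omega> \<phi>\<rbrakk> \<Longrightarrow>
      gromov_product (kobayashi_dist (punctured_hartogs \<Omega> \<phi>)) b x y \<ge>
        min (gromov_product (kobayashi_dist (punctured_hartogs \<Omega> \<phi>)) b x z)
          (gromov_product (kobayashi_dist (punctured_hartogs \<Omega> \<phi>)) b z y) - \<delta>"
    unfolding gromov_hyperbolic_def by blast
  have \<Omega>: "open \<Omega>" "connected \<Omega>" "\<Omega> \<noteq> {}"
    using assms(2) by (auto simp: C_convex_def is_domain_def)
  obtain B where "\<And>z. z \<in> \<Omega> \<Longrightarrow> \<bar>\<phi> z\<bar> \<le> B"
    using assms(3) by (auto simp: bounded_iff)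
  then interpret hartogs_weight \<Omega> \<phi> B
    using \<Omega> assms(4) by unfold_locales auto
  obtain z\<^sub>0 where z0: "z\<^sub>0 \<in> \<Omega>" using \<Omega>(3) by blast
  define a where "a = 1 / 2 + 3 / 4 * ln (1 + 2 * B)"
  have "eventually (\<lambda>L. (log 2 (2 * L + 2) + 3) * \<delta> < L - a) at_top"
    by real_asymp
  then obtain L\<^sub>0 where L0: "\<And>L. L\<^sub>0 \<le> L \<Longrightarrow> (log 2 (2 * L + 2) + 3) * \<delta> < L - a"
    by (auto simp: eventually_at_top_linorder)
  obtain p where p: "p \<in> \<Omega>" "max 1 L\<^sub>0 \<le> kobayashi_dist \<Omega> z\<^sub>0 p"
    using kobayashi_dist_unbounded[OF \<Omega>(1,2) assms(1) z0] by blast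
  define L where "L = kobayashi_dist \<Omega> z\<^sub>0 p"
  define k where "k = nat \<lceil>log 2 (2 * L + 2)\<rceil>"
  have L: "1 \<le> L" "L\<^sub>0 \<le> L" using p(2) by (auto simp: L_def)
  have "0 \<le> log 2 (2 * L + 2)" using L(1) by simp
  then have k: "log 2 (2 * L + 2) \<le> real k" "real k \<le> log 2 (2 * L + 2) + 1"
    unfolding k_def by linarith+
  have "2 * L + 2 = 2 powr log 2 (2 * L + 2)" using L(1) by simp
  also have "\<dots> \<le> 2 powr real k" using k(1) by simp
  finally have "2 * L + 2 \<le> 2 ^ k" by (simp add: powr_realpow)
  then have "L - a \<le> (real k + 2) * \<delta>"
    using hyperbolicity_bound[OF hyp \<delta> z0 p(1) L_def L(1)] by (simp add: a_def algebra_simps)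
  also have "\<dots> \<le> (log 2 (2 * L + 2) + 3) * \<delta>"
    using k(2) \<delta> by (intro mult_right_mono) auto
  also have "\<dots> < L - a" using L0[OF L(2)] .
  finally show False by simp
qed

end
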